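(* Let $\mathsf k$ be an algebraically closed field, $J$ a $9$-dimensional quadratic Jordan algebra of a cubic form over $\mathsf k$ satisfying the standing assumptions of the context, and let $\upsilon,\pi_1,\dots,\pi_4,\psi_1,\psi_2,\chi_1,\chi_2$ and $z,s_i,t_i\in\mathsf k$ $(1\le i\le 4)$ be as in the context. After replacing $\psi_1,\psi_2$ by suitable nonzero scalar multiples (and changing $\chi_1,\chi_2,s_2,s_4,t_2,t_4$ accordingly), the following holds. Write $\sigma\in J$ as $\sigma=u\upsilon+\sigma_0+\sigma_{1/2}$ with $$\sigma_0=p_1\pi_1+p_2\pi_2+p_3\pi_3+p_4\pi_4\in J_0,\qquad \sigma_{1/2}=x_1\chi_1+x_2\chi_2+y_1\psi_1+y_2\psi_2\in J_{1/2},$$ and define $u^\sharp,p_i^\sharp,x_j^\sharp,y_j^\sharp$ by $u^\sharp=S(\sigma_0)$ and $$(\sigma_{1/2})^\sharp+u(\upsilon\sharp\sigma_0)=p_1^\sharp\pi_1+p_2^\sharp\pi_2+p_3^\sharp\pi_3+p_4^\sharp\pi_4\in J_0,\qquad \sigma_0\sharp\sigma_{1/2}=x_1^\sharp\chi_1+x_2^\sharp\chi_2+y_1^\sharp\psi_1+y_2^\sharp\psi_2\in J_{1/2},$$ so that $$\sigma^\sharp=u^\sharp\upsilon+p_1^\sharp\pi_1+p_2^\sharp\pi_2+p_3^\sharp\pi_3+p_4^\sharp\pi_4+x_1^\sharp\chi_1+x_2^\sharp\chi_2+y_1^\sharp\psi_1+y_2^\sharp\psi_2 .$$ Then, with $\mathsf{ST}_{ij}=s_it_j-s_jt_i$,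 $p_1^\sharp=-up_1-\big(x_1^2\mathsf{ST}_{12}+2x_1x_2\mathsf{ST}_{13}+x_2^2\mathsf{ST}_{14}+2x_1y_1\mathsf{ST}_{23}+(x_1y_2+x_2y_1)\mathsf{ST}_{24}+2x_2y_2\mathsf{ST}_{34}\big)$, $p_2^\sharp=-up_2+t_1(x_2y_1-x_1y_2)+t_2(y_1^2-zx_1^2)+2t_3(y_1y_2-zx_1x_2)+t_4(y_2^2-zx_2^2)$, $p_3^\sharp=up_3-\big(x_1y_1\mathsf{ST}_{12}+(x_1y_2+x_2y_1)\mathsf{ST}_{13}+x_2y_2\mathsf{ST}_{14}+(y_1^2+zx_1^2)\mathsf{ST}_{23}+(y_1y_2+zx_1x_2)\mathsf{ST}_{24}+(y_2^2+zx_2^2)\mathsf{ST}_{34}\big)$, $p_4^\sharp=-up_4+s_1(x_2y_1-x_1y_2)+s_2(y_1^2-zx_1^2)+2s_3(y_1y_2-zx_1x_2)+s_4(y_2^2-zx_2^2)$, $x_1^\sharp=-p_1y_1-p_3x_1+(p_2s_3-p_4t_3)x_1+(p_2s_4-p_4t_4)x_2$, $x_2^\sharp=-p_1y_2-p_3x_2-(p_2s_2-p_4t_2)x_1-(p_2s_3-p_4t_3)x_2$, $y_1^\sharp=(-zp_1+p_2s_1-p_4t_1)x_1-p_3y_1-(p_2s_3-p_4t_3)y_1-(p_2s_4-p_4t_4)y_2$, $y_2^\sharp=(-zp_1+p_2s_1-p_4t_1)x_2-p_3y_2+(p_2s_2-p_4t_2)y_1+(p_2s_3-p_4t_3)y_2$,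 $u^\sharp=-zp_1^2+p_1(p_2s_1-p_4t_1)+p_3^2-(p_2s_3-p_4t_3)^2+(p_2s_2-p_4t_2)(p_2s_4-p_4t_4)$. Moreover the cubic form defining $J$ is $$\begin{aligned}N_\Upsilon=\ &\tfrac23\big(2z\mathsf{ST}_{23}x_1+z\mathsf{ST}_{24}x_2+\mathsf{ST}_{12}y_1+\mathsf{ST}_{13}y_2\big)x_1^\sharp+\tfrac23\big(z\mathsf{ST}_{24}x_1+2z\mathsf{ST}_{34}x_2+\mathsf{ST}_{13}y_1+\mathsf{ST}_{14}y_2\big)x_2^\sharp\\&+\tfrac23\big(\mathsf{ST}_{12}x_1+\mathsf{ST}_{13}x_2+2\mathsf{ST}_{23}y_1+\mathsf{ST}_{24}y_2\big)y_1^\sharp+\tfrac23\big(\mathsf{ST}_{13}x_1+\mathsf{ST}_{14}x_2+\mathsf{ST}_{24}y_1+2\mathsf{ST}_{34}y_2\big)y_2^\sharp\\&+\tfrac13uu^\sharp+\tfrac13(2zp_1-s_1p_2+t_1p_4)p_1^\sharp+\tfrac23p_3p_3^\sharp\\&+\tfrac13\big(-s_1p_1+2(s_3^2-s_2s_4)p_2+(s_4t_2-2s_3t_3+s_2t_4)p_4\big)p_2^\sharp\\&+\tfrac13\big(t_1p_1+(s_4t_2-2s_3t_3+s_2t_4)p_2+2(t_3^2-t_2t_4)p_4\big)p_4^\sharp,\end{aligned}$$ where the denominator $3$ appears only in the expression and cancels, so that the right-hand side has only integer coefficients (thus it works also when the characteristic of $\mathsf k$ is $3$).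
   Context: **Quadratic Jordan algebra of a cubic form.** A finite-dimensional $\mathsf k$-vector space $J$ with a cubic form $N$, a quadratic map $x\mapsto x^\sharp$ and an element $\mathfrak 1$ with $N(\mathfrak 1)=1$ such that (strictly, i.e. after all field extensions) $(x^\sharp)^\sharp=N(x)x$, $\partial_yN(x)=T(x^\sharp,y)$, $\mathfrak 1\sharp y=T(y)\mathfrak 1-y$, where $x\sharp y=(x+y)^\sharp-x^\sharp-y^\sharp$ (so $x\sharp x=2x^\sharp$), $T(x,y)=\partial_xN(\mathfrak 1)\,\partial_yN(\mathfrak 1)-\partial_x\partial_yN(\mathfrak 1)$ is the bilinear trace and $T(x)=T(x,\mathfrak 1)$. Put $S(x)=T(x^\sharp)$, $S(x,y)=S(x+y)-S(x)-S(y)$, $U_xy=T(x,y)x-x^\sharp\sharp y$ and $U_{x_1,x_2}=U_{x_1+x_2}-U_{x_1}-U_{x_2}$. An idempotent is a nonzero $e$ whose square $e\bullet e=U_e\mathfrak 1$ equals $e$; it is primitive if also $e^\sharp=0$. **Standing assumptions on $J$.** $\dim J=9$, $J$ is nondegenerate and simple, $T$ is nondegenerate, and $\mathfrak 1$ is a sum of three orthogonal primitive idempotents. **Setup.** Let $\upsilon$ be a primitive idempotent, $\pi_3=\mathfrak 1-\upsilon$, and $J=J_{1/2}\oplus J_0\oplus J_1$ the Peirce decomposition, $J_{1/2}=U_{\upsilon,\pi_3}(J)$, $J_0=U_{\pi_3}(J)$, $J_1=U_\upsilon(J)=\mathsf k\upsilon$; here $\dim J_{1/2}=\dim J_0=4$.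 Let $\pi_3^\perp=\{x: T(x,\pi_3)=0\}$ and let $\pi_1,\pi_2,\pi_4$ be a basis of $J_0\cap\pi_3^\perp$ with $S(\pi_2)\ne0$, $S(\pi_4)\neq0$. Let $V\subset J_{1/2}$ be a $2$-dimensional subspace with $\pi_2\sharp V\subset V$, $\pi_4\sharp V\subset V$, $\dim(\pi_1\sharp V)=2$, $J_{1/2}=V\oplus(\pi_1\sharp V)$, and $\psi_1,\psi_2$ a basis of $V$. Put $\chi_i=-\pi_1\sharp\psi_i$ $(i=1,2)$. Then $\upsilon,\pi_1,\dots,\pi_4,\psi_1,\psi_2,\chi_1,\chi_2$ is a basis of $J$. The parameters are $z=-S(\pi_1)$, $s_1=S(\pi_1,\pi_2)$, $t_1=-S(\pi_1,\pi_4)$ and $s_2,s_3,s_4,t_2,t_3,t_4$ given by $\pi_2\sharp\psi_1=-s_3\psi_1+s_2\psi_2$, $\pi_2\sharp\psi_2=-s_4\psi_1+s_3\psi_2$, $\pi_4\sharp\psi_1=t_3\psi_1-t_2\psi_2$, $\pi_4\sharp\psi_2=t_4\psi_1-t_3\psi_2$, where the choices are made so that $s_2,s_3,s_4,t_2,t_3,t_4$ are all nonzero. *)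

theory Defs
  imports
    "HOL-Computational_Algebra.Polynomial"
    "HOL-Library.Poly_Mapping"
begin

section \<open>Quadratic Jordan algebras of cubic forms\<close>

text \<open>
  The derivative of a polynomial function \<open>f\<close> at \<open>x\<close> in direction \<open>y\<close>, i.e. the coefficient of
  \<open>t\<close> in \<open>f (x + t y)\<close>. The polynomial is unique because the field is infinite.
\<close>
definition dir_deriv ::
    "('k::alg_closed_field \<Rightarrow> 'v::ab_group_add \<Rightarrow> 'v) \<Rightarrow> 'v \<Rightarrow> ('v \<Rightarrow> 'k) \<Rightarrow> 'v \<Rightarrow> 'k" where
  "dir_deriv scale y f x = coeff (THE q. \<forall>t. f (x + scale t y) = poly q t) 1"

text \<open>
  The homogeneous cubic polynomials on a finite-dimensional space are, in every characteristic,
  the restrictions to the diagonal of (not necessarily symmetric) trilinear forms.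
\<close>
definition cubic_form :: "('k::field \<Rightarrow> 'v::ab_group_add \<Rightarrow> 'v) \<Rightarrow> ('v \<Rightarrow> 'k) \<Rightarrow> bool" where
  "cubic_form scale N \<longleftrightarrow> (\<exists>M.
     (\<forall>y z. Vector_Spaces.linear scale (*) (\<lambda>x. M x y z)) \<and>
     (\<forall>x z. Vector_Spaces.linear scale (*) (\<lambda>y. M x y z)) \<and>
     (\<forall>x y. Vector_Spaces.linear scale (*) (\<lambda>z. M x y z)) \<and>
     (\<forall>x. N x = M x x x))"

definition quadratic_map :: "('k::field \<Rightarrow> 'v::ab_group_add \<Rightarrow> 'v) \<Rightarrow> ('v \<Rightarrow> 'v) \<Rightarrow> bool" where
  "quadratic_map scale q \<longleftrightarrow>
     (\<forall>a x. q (scale a x) = scale (a\<^sup>2) (q x)) \<and>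
     (\<forall>y. Vector_Spaces.linear scale scale (\<lambda>x. q (x + y) - q x - q y)) \<and>
     (\<forall>x. Vector_Spaces.linear scale scale (\<lambda>y. q (x + y) - q x - q y))"

text \<open>In a family of vectors given as a list, repetitions count as linear dependence.\<close>
definition basis_of ::
    "('k::field \<Rightarrow> 'v::ab_group_add \<Rightarrow> 'v) \<Rightarrow> 'v list \<Rightarrow> 'v set \<Rightarrow> bool" where
  "basis_of scale bs W \<longleftrightarrow>
     distinct bs \<and> \<not> module.dependent scale (set bs) \<and> module.span scale (set bs) = W"

locale jordan_data = vector_space scale
  for scale :: "'k::alg_closed_field \<Rightarrow> 'v::ab_group_add \<Rightarrow> 'v" (infixr "*s" 75) +
  fixes N :: "'v \<Rightarrow> 'k"
    and sharp :: "'v \<Rightarrow> 'v"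
    and one :: 'v
begin

definition cross :: "'v \<Rightarrow> 'v \<Rightarrow> 'v" (infixl "\<sharp>" 70) where
  "x \<sharp> y = sharp (x + y) - sharp x - sharp y"

definition T :: "'v \<Rightarrow> 'v \<Rightarrow> 'k" where
  "T x y = dir_deriv scale x N one * dir_deriv scale y N one
           - dir_deriv scale x (dir_deriv scale y N) one"

definition trace :: "'v \<Rightarrow> 'k" where
  "trace x = T x one"

definition S :: "'v \<Rightarrow> 'k" where
  "S x = trace (sharp x)"

definition S2 :: "'v \<Rightarrow> 'v \<Rightarrow> 'k" where
  "S2 x y = S (x + y) - S x - S y"

definition U :: "'v \<Rightarrow> 'v \<Rightarrow> 'v" where
  "U x y = T x y *s x - sharp x \<sharp> y"

definition U2 :: "'v \<Rightarrow> 'v \<Rightarrow> 'v \<Rightarrow> 'v" where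
  "U2 x1 x2 y = U (x1 + x2) y - U x1 y - U x2 y"

definition idempotent :: "'v \<Rightarrow> bool" where
  "idempotent e \<longleftrightarrow> e \<noteq> 0 \<and> U e one = e"

definition primitive_idempotent :: "'v \<Rightarrow> bool" where
  "primitive_idempotent e \<longleftrightarrow> idempotent e \<and> sharp e = 0"

text \<open>Orthogonality of idempotents in the sense of quadratic Jordan algebras.\<close>
definition orthogonal_idempotents :: "'v \<Rightarrow> 'v \<Rightarrow> bool" where
  "orthogonal_idempotents e f \<longleftrightarrow> U e f = 0 \<and> U f e = 0 \<and> U2 e f one = 0"

definition nondegenerate :: bool where
  "nondegenerate \<longleftrightarrow> (\<forall>x. (\<forall>y. U x y = 0) \<longrightarrow> x = 0)"

definition jordan_ideal :: "'v set \<Rightarrow> bool" where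
  "jordan_ideal I \<longleftrightarrow> subspace I \<and>
     (\<forall>a\<in>I. \<forall>x. U a x \<in> I) \<and> (\<forall>a\<in>I. \<forall>x. U x a \<in> I) \<and> (\<forall>a\<in>I. \<forall>x y. U2 x a y \<in> I)"

definition simple :: bool where
  "simple \<longleftrightarrow> (\<exists>x y. U x y \<noteq> 0) \<and> (\<forall>I. jordan_ideal I \<longrightarrow> I = {0} \<or> I = UNIV)"

definition trace_nondegenerate :: bool where
  "trace_nondegenerate \<longleftrightarrow> (\<forall>x. (\<forall>y. T x y = 0) \<longrightarrow> x = 0)"

definition one_sum_of_three_primitives :: bool where
  "one_sum_of_three_primitives \<longleftrightarrow> (\<exists>e1 e2 e3.
     primitive_idempotent e1 \<and> primitive_idempotent e2 \<and> primitive_idempotent e3 \<and>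
     orthogonal_idempotents e1 e2 \<and> orthogonal_idempotents e1 e3 \<and>
     orthogonal_idempotents e2 e3 \<and> one = e1 + e2 + e3)"

definition peirce_half :: "'v \<Rightarrow> 'v set" where
  "peirce_half e = range (U2 e (one - e))"

definition peirce_zero :: "'v \<Rightarrow> 'v set" where
  "peirce_zero e = range (U (one - e))"

end

text \<open>
  The identities are polynomial in \<open>x\<close> and \<open>y\<close>. Since \<open>'k\<close> is algebraically closed, hence infinite,
  their validity on the given space is the same as their strict validity, i.e. validity
  after every field extension.
\<close>
locale cubic_jordan_algebra = jordan_data +
  assumes finite_dimensional: "\<exists>B. finite B \<and> span B = UNIV"
    and cubic_form: "cubic_form scale N"
    and quadratic_sharp: "quadratic_map scale sharp"
    and norm_one: "N one = 1"
    and adjoint_identity: "sharp (sharp x) = N x *s x"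
    and trace_sharp: "dir_deriv scale y N x = T (sharp x) y"
    and unit_sharp: "one \<sharp> y = trace y *s one - y"

text \<open>
  Families are indexed as on paper: \<open>\<pi> 1, \<dots>, \<pi> 4\<close>; \<open>\<psi> 1, \<psi> 2\<close>; \<open>\<chi> 1, \<chi> 2\<close>; \<open>s 1, \<dots>, s 4\<close>;
  \<open>t 1, \<dots>, t 4\<close>. Values at other indices are irrelevant.
  Note that \<open>basis\<close> cannot hold in characteristic 2, where \<open>T (\<pi> 3) (\<pi> 3) = 2 = 0\<close> puts \<open>\<pi> 3\<close> in the
  span of \<open>\<pi> 1\<close>, \<open>\<pi> 2\<close>, \<open>\<pi> 4\<close>; otherwise it follows from the other conditions.
\<close>
locale peirce_frame = cubic_jordan_algebra +
  fixes \<upsilon> :: 'b and \<pi> :: "nat \<Rightarrow> 'b" and V :: "'b set" and \<psi> \<chi> :: "nat \<Rightarrow> 'b"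
    and z :: 'a and s t :: "nat \<Rightarrow> 'a"
  assumes primitive: "primitive_idempotent \<upsilon>"
    and pi3: "\<pi> 3 = one - \<upsilon>"
    and pi_basis: "basis_of scale [\<pi> 1, \<pi> 2, \<pi> 4] (peirce_zero \<upsilon> \<inter> {x. T x (\<pi> 3) = 0})"
    and S_pi2: "S (\<pi> 2) \<noteq> 0" and S_pi4: "S (\<pi> 4) \<noteq> 0"
    and psi_basis: "basis_of scale [\<psi> 1, \<psi> 2] V"
    and V_half: "V \<subseteq> peirce_half \<upsilon>"
    and pi2_V: "(\<lambda>v. \<pi> 2 \<sharp> v) ` V \<subseteq> V" and pi4_V: "(\<lambda>v. \<pi> 4 \<sharp> v) ` V \<subseteq> V"
    and dim_pi1_V: "dim ((\<lambda>v. \<pi> 1 \<sharp> v) ` V) = 2"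
    and half_sum: "peirce_half \<upsilon> = {v + w | v w. v \<in> V \<and> w \<in> (\<lambda>v. \<pi> 1 \<sharp> v) ` V}"
    and half_direct: "V \<inter> (\<lambda>v. \<pi> 1 \<sharp> v) ` V = {0}"
    and chi1: "\<chi> 1 = - (\<pi> 1 \<sharp> \<psi> 1)" and chi2: "\<chi> 2 = - (\<pi> 1 \<sharp> \<psi> 2)"
    and basis: "basis_of scale [\<upsilon>, \<pi> 1, \<pi> 2, \<pi> 3, \<pi> 4, \<psi> 1, \<psi> 2, \<chi> 1, \<chi> 2] UNIV"
    and z: "z = - S (\<pi> 1)"
    and s1: "s 1 = S2 (\<pi> 1) (\<pi> 2)" and t1: "t 1 = - S2 (\<pi> 1) (\<pi> 4)"
    and pi2_psi1: "\<pi> 2 \<sharp> \<psi> 1 = - (s 3 *s \<psi> 1) + s 2 *s \<psi> 2"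
    and pi2_psi2: "\<pi> 2 \<sharp> \<psi> 2 = - (s 4 *s \<psi> 1) + s 3 *s \<psi> 2"
    and pi4_psi1: "\<pi> 4 \<sharp> \<psi> 1 = t 3 *s \<psi> 1 - t 2 *s \<psi> 2"
    and pi4_psi2: "\<pi> 4 \<sharp> \<psi> 2 = t 4 *s \<psi> 1 - t 3 *s \<psi> 2"
    and nonzero: "s 2 \<noteq> 0" "s 3 \<noteq> 0" "s 4 \<noteq> 0" "t 2 \<noteq> 0" "t 3 \<noteq> 0" "t 4 \<noteq> 0"


section \<open>The explicit formulas\<close>

text \<open>
  All formulas take the same arguments: the parameters \<open>z, s, t\<close> and the coordinates
  \<open>u, p, x, y\<close>. They are polymorphic so that \<open>N_Upsilon\<close> can also be read over the rationals.
\<close>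

definition ST :: "(nat \<Rightarrow> 'a::comm_ring_1) \<Rightarrow> (nat \<Rightarrow> 'a) \<Rightarrow> nat \<Rightarrow> nat \<Rightarrow> 'a" where
  "ST s t i j = s i * t j - s j * t i"

type_synonym 'a formula =
  "'a \<Rightarrow> (nat \<Rightarrow> 'a) \<Rightarrow> (nat \<Rightarrow> 'a) \<Rightarrow> 'a \<Rightarrow> (nat \<Rightarrow> 'a) \<Rightarrow> (nat \<Rightarrow> 'a) \<Rightarrow> (nat \<Rightarrow> 'a) \<Rightarrow> 'a"

definition p1_sharp :: "'a::comm_ring_1 formula" where
  "p1_sharp z s t u p x y = - u * p 1
     - ((x 1)\<^sup>2 * ST s t 1 2 + 2 * x 1 * x 2 * ST s t 1 3 + (x 2)\<^sup>2 * ST s t 1 4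
        + 2 * x 1 * y 1 * ST s t 2 3 + (x 1 * y 2 + x 2 * y 1) * ST s t 2 4
        + 2 * x 2 * y 2 * ST s t 3 4)"

definition p2_sharp :: "'a::comm_ring_1 formula" where
  "p2_sharp z s t u p x y = - u * p 2 + t 1 * (x 2 * y 1 - x 1 * y 2)
     + t 2 * ((y 1)\<^sup>2 - z * (x 1)\<^sup>2) + 2 * t 3 * (y 1 * y 2 - z * x 1 * x 2)
     + t 4 * ((y 2)\<^sup>2 - z * (x 2)\<^sup>2)"

definition p3_sharp :: "'a::comm_ring_1 formula" where
  "p3_sharp z s t u p x y = u * p 3
     - (x 1 * y 1 * ST s t 1 2 + (x 1 * y 2 + x 2 * y 1) * ST s t 1 3 + x 2 * y 2 * ST s t 1 4
        + ((y 1)\<^sup>2 + z * (x 1)\<^sup>2) * ST s t 2 3 + (y 1 * y 2 + z * x 1 * x 2) * ST s t 2 4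
        + ((y 2)\<^sup>2 + z * (x 2)\<^sup>2) * ST s t 3 4)"

definition p4_sharp :: "'a::comm_ring_1 formula" where
  "p4_sharp z s t u p x y = - u * p 4 + s 1 * (x 2 * y 1 - x 1 * y 2)
     + s 2 * ((y 1)\<^sup>2 - z * (x 1)\<^sup>2) + 2 * s 3 * (y 1 * y 2 - z * x 1 * x 2)
     + s 4 * ((y 2)\<^sup>2 - z * (x 2)\<^sup>2)"

definition x1_sharp :: "'a::comm_ring_1 formula" where
  "x1_sharp z s t u p x y = - p 1 * y 1 - p 3 * x 1
     + (p 2 * s 3 - p 4 * t 3) * x 1 + (p 2 * s 4 - p 4 * t 4) * x 2"

definition x2_sharp :: "'a::comm_ring_1 formula" where
  "x2_sharp z s t u p x y = - p 1 * y 2 - p 3 * x 2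
     - (p 2 * s 2 - p 4 * t 2) * x 1 - (p 2 * s 3 - p 4 * t 3) * x 2"

definition y1_sharp :: "'a::comm_ring_1 formula" where
  "y1_sharp z s t u p x y = (- z * p 1 + p 2 * s 1 - p 4 * t 1) * x 1 - p 3 * y 1
     - (p 2 * s 3 - p 4 * t 3) * y 1 - (p 2 * s 4 - p 4 * t 4) * y 2"

definition y2_sharp :: "'a::comm_ring_1 formula" where
  "y2_sharp z s t u p x y = (- z * p 1 + p 2 * s 1 - p 4 * t 1) * x 2 - p 3 * y 2
     + (p 2 * s 2 - p 4 * t 2) * y 1 + (p 2 * s 3 - p 4 * t 3) * y 2"

definition u_sharp :: "'a::comm_ring_1 formula" where
  "u_sharp z s t u p x y = - z * (p 1)\<^sup>2 + p 1 * (p 2 * s 1 - p 4 * t 1) + (p 3)\<^sup>2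
     - (p 2 * s 3 - p 4 * t 3)\<^sup>2 + (p 2 * s 2 - p 4 * t 2) * (p 2 * s 4 - p 4 * t 4)"

text \<open>Division by 3 makes this meaningless in characteristic 3, where \<open>1 / 3 = 0\<close> in HOL.\<close>
definition N_Upsilon :: "'a::field formula" where
  "N_Upsilon z s t u p x y =
     2/3 * (2 * z * ST s t 2 3 * x 1 + z * ST s t 2 4 * x 2 + ST s t 1 2 * y 1 + ST s t 1 3 * y 2)
         * x1_sharp z s t u p x y
   + 2/3 * (z * ST s t 2 4 * x 1 + 2 * z * ST s t 3 4 * x 2 + ST s t 1 3 * y 1 + ST s t 1 4 * y 2)
         * x2_sharp z s t u p x y
   + 2/3 * (ST s t 1 2 * x 1 + ST s t 1 3 * x 2 + 2 * ST s t 2 3 * y 1 + ST s t 2 4 * y 2)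
         * y1_sharp z s t u p x y
   + 2/3 * (ST s t 1 3 * x 1 + ST s t 1 4 * x 2 + ST s t 2 4 * y 1 + 2 * ST s t 3 4 * y 2)
         * y2_sharp z s t u p x y
   + 1/3 * u * u_sharp z s t u p x y
   + 1/3 * (2 * z * p 1 - s 1 * p 2 + t 1 * p 4) * p1_sharp z s t u p x y
   + 2/3 * p 3 * p3_sharp z s t u p x y
   + 1/3 * (- s 1 * p 1 + 2 * ((s 3)\<^sup>2 - s 2 * s 4) * p 2
            + (s 4 * t 2 - 2 * s 3 * t 3 + s 2 * t 4) * p 4) * p2_sharp z s t u p x y
   + 1/3 * (t 1 * p 1 + (s 4 * t 2 - 2 * s 3 * t 3 + s 2 * t 4) * p 2
            + 2 * ((t 3)\<^sup>2 - t 2 * t 4) * p 4) * p4_sharp z s t u p x y"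

text \<open>
  Integer polynomials in variables from \<open>'x\<close>: finitely supported maps from monomials (exponent
  vectors of finite support) to coefficients, evaluated in an arbitrary commutative ring.
\<close>
definition eval_int_poly ::
    "(('x \<Rightarrow>\<^sub>0 nat) \<Rightarrow>\<^sub>0 int) \<Rightarrow> ('x \<Rightarrow> 'a::comm_ring_1) \<Rightarrow> 'a" where
  "eval_int_poly P a =
     (\<Sum>m\<in>Poly_Mapping.keys P. of_int (Poly_Mapping.lookup P m) *
        (\<Prod>v\<in>Poly_Mapping.keys m. a v ^ Poly_Mapping.lookup m v))"

datatype upsilon_var = VZ | VS nat | VT nat | VU | VP nat | VX nat | VY nat

fun assignment :: "'a \<Rightarrow> (nat \<Rightarrow> 'a) \<Rightarrow> (nat \<Rightarrow> 'a) \<Rightarrow> 'a \<Rightarrow> (nat \<Rightarrow> 'a) \<Rightarrow> (nat \<Rightarrow> 'a) \<Rightarrow> (nat \<Rightarrow> 'a)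
    \<Rightarrow> upsilon_var \<Rightarrow> 'a" where
  "assignment z s t u p x y VZ = z"
| "assignment z s t u p x y (VS i) = s i"
| "assignment z s t u p x y (VT i) = t i"
| "assignment z s t u p x y VU = u"
| "assignment z s t u p x y (VP i) = p i"
| "assignment z s t u p x y (VX i) = x i"
| "assignment z s t u p x y (VY i) = y i"

end

theory Submission
  imports Defs
begin

text \<open>
  Everything rests on one rigidity phenomenon. Write \<open>J\<^sub>0'\<close> for the trace zero part of \<open>J\<^sub>0\<close>. For
  \<open>a\<close> in \<open>J\<^sub>0'\<close> and \<open>h\<close> in \<open>J\<^bsub>1/2\<^esub>\<close> one has \<open>a \<sharp> (a \<sharp> h) = - S(a) h\<close> (lemma \<open>clifford_relation\<close>), so
  \<open>J\<^bsub>1/2\<^esub>\<close> is a module over the Clifford algebra of \<open>(J\<^sub>0', - S)\<close>. The matrices of \<open>\<pi>\<^sub>2\<close> and \<open>\<pi>\<^sub>4\<close> on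
  \<open>V\<close> and the values \<open>S(\<pi>\<^sub>1)\<close>, \<open>S(\<pi>\<^sub>1, \<pi>\<^sub>2)\<close>, \<open>S(\<pi>\<^sub>1, \<pi>\<^sub>4)\<close> therefore determine the whole action of
  \<open>J\<^sub>0\<close> on \<open>J\<^bsub>1/2\<^esub>\<close> as well as the quadratic form \<open>S\<close> on \<open>J\<^sub>0\<close>. This yields \<open>u\<^sup>\<sharp>\<close>, \<open>x\<^sub>j\<^sup>\<sharp>\<close> and \<open>y\<^sub>j\<^sup>\<sharp>\<close>
  before any normalisation.

  What remains is the quadratic map \<open>h \<mapsto> h\<^sup>\<sharp>\<close> from \<open>J\<^bsub>1/2\<^esub>\<close> to \<open>J\<^sub>0\<close>. Since \<open>T(h\<^sup>\<sharp>, a)\<close> is half of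
  \<open>T(h, a \<sharp> h)\<close> and \<open>T\<close> is nondegenerate, this map is determined by the restriction of \<open>T\<close> to \<open>J\<^bsub>1/2\<^esub>\<close>.
  That restriction is a symmetric bilinear form for which every \<open>a \<in> J\<^sub>0'\<close> acts as a self-adjoint
  operator, and such a form is unique up to a scalar: in coordinates, self-adjointness is a
  homogeneous linear system in six unknowns whose solutions are the multiples of the vector of
  the \<open>2 \<times> 2\<close> minors \<open>ST\<^sub>i\<^sub>j\<close> (lemma \<open>self_adjoint_unique\<close>). Multiplying both \<open>\<psi>\<^sub>1\<close> and \<open>\<psi>\<^sub>2\<close> by one scalar
  \<open>c\<close> multiplies the form by \<open>c\<^sup>2\<close> and leaves all parameters alone, so over an algebraically closed
  field the scalar can be normalised. The formulas for \<open>p\<^sub>i\<^sup>\<sharp>\<close> are then checked by pairing with \<open>J\<^sub>0\<close>,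
  which is a polynomial identity (lemma \<open>half_trace_half_sharp\<close>).

  The norm vanishes on \<open>J\<^sub>0\<close> and on \<open>J\<^bsub>1/2\<^esub>\<close>, because \<open>N(x) x = (x\<^sup>\<sharp>)\<^sup>\<sharp>\<close> lies in \<open>J\<^sub>1\<close> for such \<open>x\<close>. Hence
  \<open>N(\<sigma>) = u S(\<sigma>\<^sub>0) + T(\<sigma>\<^sub>0, (\<sigma>\<^bsub>1/2\<^esub>)\<^sup>\<sharp>)\<close>. This expression has integer coefficients in the coordinates and
  holds in every characteristic that occurs; wherever 3 is invertible it agrees with the
  displayed formula for the norm.
\<close>

section \<open>Polynomial functions over an algebraically closed field\<close>

lemma alg_closed_field_infinite: "infinite (UNIV :: 'k::alg_closed_field set)"
proof
  assume fin: "finite (UNIV :: 'k set)"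
  \<comment> \<open>The polynomial \<open>q + 1\<close> takes the value 1 everywhere, so it has no root.\<close>
  define q :: "'k poly" where "q = (\<Prod>a\<in>UNIV. [:- a, 1:])"
  have "degree q = card (UNIV :: 'k set)"
    unfolding q_def by (subst degree_prod_sum_eq) auto
  with fin have "degree (q + 1) > 0"
    by (subst degree_add_eq_left) (auto simp: card_gt_0_iff)
  then obtain r where "poly (q + 1) r = 0"
    using alg_closed_imp_poly_has_root by blast
  moreover have "poly q r = 0"
    using fin by (auto simp: q_def poly_prod intro!: prod_zero bexI[of _ r])
  ultimately show False by simp
qed

lemma poly_eq_if_eval_eq:
  fixes p q :: "'k::alg_closed_field poly"
  assumes "\<And>t. poly p t = poly q t"
  shows "p = q"
proof (rule ccontr)
  assume "p \<noteq> q"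
  then have "finite {t. poly (p - q) t = 0}" by (intro poly_roots_finite) simp
  moreover have "{t. poly (p - q) t = 0} = UNIV" using assms by simp
  ultimately show False using alg_closed_field_infinite by metis
qed

text \<open>
  The definite description in \<open>dir_deriv\<close> is harmless: over an infinite field a polynomial
  function has only one polynomial.
\<close>
lemma dir_deriv_eq_coeff:
  assumes "\<And>t. f (x + scale t y) = poly q t"
  shows "dir_deriv scale y f x = coeff q 1"
proof -
  have "(THE q. \<forall>t. f (x + scale t y) = poly q t) = q"
    using assms by (intro the_equality) (auto intro: poly_eq_if_eval_eq)
  then show ?thesis by (simp add: dir_deriv_def)
qed

section \<open>Evaluation of integer polynomials\<close>

definition monomial_value :: "('x \<Rightarrow> 'a::comm_ring_1) \<Rightarrow> ('x \<Rightarrow>\<^sub>0 nat) \<Rightarrow> 'a" where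
  "monomial_value a m = (\<Prod>v\<in>Poly_Mapping.keys m. a v ^ Poly_Mapping.lookup m v)"

lemma monomial_value_superset:
  assumes "finite A" "Poly_Mapping.keys m \<subseteq> A"
  shows "monomial_value a m = (\<Prod>v\<in>A. a v ^ Poly_Mapping.lookup m v)"
  unfolding monomial_value_def
  using assms by (intro prod.mono_neutral_left) (auto simp: in_keys_iff)

lemma monomial_value_add: "monomial_value a (m + n) = monomial_value a m * monomial_value a n"
proof -
  let ?A = "Poly_Mapping.keys m \<union> Poly_Mapping.keys n"
  have fin: "finite ?A" by simp
  show ?thesis
    using monomial_value_superset[OF fin, of m a] monomial_value_superset[OF fin, of n a]
      monomial_value_superset[OF fin keys_add, of a]
    by (simp add: lookup_add power_add prod.distrib)
qed

lemma eval_int_poly_superset: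
  assumes "finite A" "Poly_Mapping.keys P \<subseteq> A"
  shows "eval_int_poly P a = (\<Sum>m\<in>A. of_int (Poly_Mapping.lookup P m) * monomial_value a m)"
  unfolding eval_int_poly_def monomial_value_def
  using assms by (intro sum.mono_neutral_left) (auto simp: in_keys_iff)

lemma eval_int_poly_add: "eval_int_poly (P + Q) a = eval_int_poly P a + eval_int_poly Q a"
proof -
  let ?A = "Poly_Mapping.keys P \<union> Poly_Mapping.keys Q"
  have fin: "finite ?A" by simp
  show ?thesis
    using eval_int_poly_superset[OF fin, of P a] eval_int_poly_superset[OF fin, of Q a]
      eval_int_poly_superset[OF fin keys_add, of a]
    by (simp add: lookup_add distrib_right sum.distrib)
qed

lemma eval_int_poly_single:
  "eval_int_poly (Poly_Mapping.single m c) a = of_int c * monomial_value a m"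
  by (simp add: eval_int_poly_def monomial_value_def)

lemma eval_int_poly_zero [simp]: "eval_int_poly 0 a = 0"
  by (simp add: eval_int_poly_def)

lemma eval_int_poly_uminus: "eval_int_poly (- P) a = - eval_int_poly P a"
  using eval_int_poly_add[of P "- P" a] by (simp add: eq_neg_iff_add_eq_0 add.commute)

lemma eval_int_poly_diff: "eval_int_poly (P - Q) a = eval_int_poly P a - eval_int_poly Q a"
  using eval_int_poly_add[of P "- Q" a] by (simp add: eval_int_poly_uminus)

text \<open>
  Evaluation is additive, so it suffices to build polynomials by adding monomials; this makes
  multiplicativity of the evaluation a matter of monomials.
\<close>
lemma int_poly_induct [case_names zero single_add]:
  fixes P :: "'m \<Rightarrow>\<^sub>0 int"
  assumes "R 0" and "\<And>m c P. R P \<Longrightarrow> R (Poly_Mapping.single m c + P)"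
  shows "R P"
proof (induction P rule: update_induct)
  case const
  show ?case by (rule assms)
next
  case (update f a b)
  have "Poly_Mapping.update a b f = Poly_Mapping.single a b + f"
    using update by (intro poly_mapping_eqI)
      (auto simp: lookup_update lookup_add lookup_single in_keys_iff when_def)
  with update assms(2) show ?case by metis
qed

lemma eval_int_poly_mult: "eval_int_poly (P * Q) a = eval_int_poly P a * eval_int_poly Q a"
proof -
  have single: "eval_int_poly (Poly_Mapping.single m c * Q) a
      = eval_int_poly (Poly_Mapping.single m c) a * eval_int_poly Q a" for m c
    by (induction Q rule: int_poly_induct)
      (simp_all add: distrib_left eval_int_poly_add mult_single eval_int_poly_single
        monomial_value_add mult_ac)
  show ?thesis
    by (induction P rule: int_poly_induct)
      (simp_all add: distrib_right eval_int_poly_add single)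
qed

lemma eval_int_poly_one [simp]: "eval_int_poly 1 a = 1"
  by (simp add: eval_int_poly_single monomial_value_def flip: single_one)

lemma eval_int_poly_numeral: "eval_int_poly (numeral n) a = numeral n"
  by (simp add: eval_int_poly_single monomial_value_def flip: single_numeral)

lemma eval_int_poly_power: "eval_int_poly (P ^ n) a = eval_int_poly P a ^ n"
  by (induction n) (simp_all add: eval_int_poly_mult)

definition indeterminate :: "'x \<Rightarrow> ('x \<Rightarrow>\<^sub>0 nat) \<Rightarrow>\<^sub>0 int" where
  "indeterminate v = Poly_Mapping.single (Poly_Mapping.single v 1) 1"

lemma eval_int_poly_indeterminate: "eval_int_poly (indeterminate v) a = a v"
  by (simp add: indeterminate_def eval_int_poly_single monomial_value_def)

lemmas eval_int_poly_hom = eval_int_poly_add eval_int_poly_diff eval_int_poly_uminus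
  eval_int_poly_mult eval_int_poly_power eval_int_poly_numeral eval_int_poly_indeterminate

section \<open>Polynomial identities between the explicit formulas\<close>

text \<open>
  The Gram matrix of \<open>T\<close> on \<open>J\<^sub>0\<close>: this is \<open>T(p\<^sub>1\<pi>\<^sub>1 + \<dots> + p\<^sub>4\<pi>\<^sub>4, q\<^sub>1\<pi>\<^sub>1 + \<dots> + q\<^sub>4\<pi>\<^sub>4)\<close>.
\<close>
definition trace_zero :: "'a::comm_ring_1 \<Rightarrow> (nat \<Rightarrow> 'a) \<Rightarrow> (nat \<Rightarrow> 'a) \<Rightarrow> (nat \<Rightarrow> 'a)
    \<Rightarrow> 'a \<Rightarrow> 'a \<Rightarrow> 'a \<Rightarrow> 'a \<Rightarrow> 'a" where
  "trace_zero z s t p q1 q2 q3 q4 =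
     (2 * z * p 1 - s 1 * p 2 + t 1 * p 4) * q1 + 2 * p 3 * q3
   + (- s 1 * p 1 + 2 * ((s 3)\<^sup>2 - s 2 * s 4) * p 2
       + (s 4 * t 2 - 2 * s 3 * t 3 + s 2 * t 4) * p 4) * q2
   + (t 1 * p 1 + (s 4 * t 2 - 2 * s 3 * t 3 + s 2 * t 4) * p 2
       + 2 * ((t 3)\<^sup>2 - t 2 * t 4) * p 4) * q4"

text \<open>
  Half of the trace form of two elements of \<open>J\<^bsub>1/2\<^esub>\<close> with coordinates \<open>(x, y)\<close> and \<open>(a, b)\<close>, after the
  rescaling of \<open>\<psi>\<^sub>1\<close> and \<open>\<psi>\<^sub>2\<close>. Halving keeps the coefficients of the formula for the norm visible.
\<close>
definition half_trace_half :: "'a::comm_ring_1 \<Rightarrow> (nat \<Rightarrow> 'a) \<Rightarrow> (nat \<Rightarrow> 'a) \<Rightarrow> (nat \<Rightarrow> 'a)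
    \<Rightarrow> (nat \<Rightarrow> 'a) \<Rightarrow> 'a \<Rightarrow> 'a \<Rightarrow> 'a \<Rightarrow> 'a \<Rightarrow> 'a" where
  "half_trace_half z s t x y a1 a2 b1 b2 =
     (2 * z * ST s t 2 3 * x 1 + z * ST s t 2 4 * x 2 + ST s t 1 2 * y 1 + ST s t 1 3 * y 2) * a1
   + (z * ST s t 2 4 * x 1 + 2 * z * ST s t 3 4 * x 2 + ST s t 1 3 * y 1 + ST s t 1 4 * y 2) * a2
   + (ST s t 1 2 * x 1 + ST s t 1 3 * x 2 + 2 * ST s t 2 3 * y 1 + ST s t 2 4 * y 2) * b1
   + (ST s t 1 3 * x 1 + ST s t 1 4 * x 2 + ST s t 2 4 * y 1 + 2 * ST s t 3 4 * y 2) * b2"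

text \<open>
  The norm as \<open>u S(\<sigma>\<^sub>0) + T(\<sigma>\<^sub>0, (\<sigma>\<^bsub>1/2\<^esub>)\<^sup>\<sharp>)\<close>. Putting \<open>u = 0\<close> in the formulas for \<open>p\<^sub>i\<^sup>\<sharp>\<close> leaves the
  coordinates of \<open>(\<sigma>\<^bsub>1/2\<^esub>)\<^sup>\<sharp>\<close>. No denominators occur, which is what makes this version meaningful in
  characteristic 3.
\<close>
definition norm_formula :: "'a::comm_ring_1 formula" where
  "norm_formula z s t u p x y = u * u_sharp z s t u p x y
     + trace_zero z s t p (p1_sharp z s t 0 p x y) (p2_sharp z s t 0 p x y)
         (p3_sharp z s t 0 p x y) (p4_sharp z s t 0 p x y)"

lemmas formula_defs = p1_sharp_def p2_sharp_def p3_sharp_def p4_sharp_def x1_sharp_def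
  x2_sharp_def y1_sharp_def y2_sharp_def u_sharp_def ST_def

text \<open>
  In coordinates this is \<open>T(h, a \<sharp> h) = 2 T(a, h\<^sup>\<sharp>)\<close>, divided by 2. It is used twice: to identify \<open>h\<^sup>\<sharp>\<close>
  from its pairings with \<open>J\<^sub>0\<close>, and to relate the two formulas for the norm.
\<close>
lemma half_trace_half_sharp:
  fixes z :: "'a::comm_ring_1"
  shows "half_trace_half z s t x y (x1_sharp z s t u p x y) (x2_sharp z s t u p x y)
       (y1_sharp z s t u p x y) (y2_sharp z s t u p x y)
     = trace_zero z s t p (p1_sharp z s t 0 p x y) (p2_sharp z s t 0 p x y)
         (p3_sharp z s t 0 p x y) (p4_sharp z s t 0 p x y)"
  unfolding half_trace_half_def trace_zero_def formula_defs
  by (simp add: algebra_simps power2_eq_square)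

text \<open>
  The difference is \<open>u T(\<sigma>\<^sub>0, \<upsilon> \<sharp> \<sigma>\<^sub>0) = 2 u T(\<sigma>\<^sub>0\<^sup>\<sharp>, \<upsilon>) = 2 u S(\<sigma>\<^sub>0)\<close>.
\<close>
lemma trace_zero_sharp:
  fixes z :: "'a::comm_ring_1"
  shows "trace_zero z s t p (p1_sharp z s t u p x y) (p2_sharp z s t u p x y)
       (p3_sharp z s t u p x y) (p4_sharp z s t u p x y)
    = trace_zero z s t p (p1_sharp z s t 0 p x y) (p2_sharp z s t 0 p x y)
         (p3_sharp z s t 0 p x y) (p4_sharp z s t 0 p x y) + 2 * u * u_sharp z s t u p x y"
  unfolding trace_zero_def formula_defs
  by (simp add: algebra_simps power2_eq_square)

text \<open>
  The displayed formula is Euler's identity \<open>3 N(\<sigma>) = T(\<sigma>, \<sigma>\<^sup>\<sharp>)\<close> divided by 3. By the two preceding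
  identities each of the summands \<open>u S(\<sigma>\<^sub>0)\<close> and \<open>T(\<sigma>\<^sub>0, (\<sigma>\<^bsub>1/2\<^esub>)\<^sup>\<sharp>)\<close> occurs in \<open>T(\<sigma>, \<sigma>\<^sup>\<sharp>)\<close> exactly
  three times.
\<close>
lemma N_Upsilon_eq_norm_formula:
  fixes z :: "'a::field"
  assumes three: "(3::'a) \<noteq> 0"
  shows "N_Upsilon z s t u p x y = norm_formula z s t u p x y"
proof -
  define k :: 'a where "k = 1/3"
  have k: "2/3 = 2 * k" "1/3 = k" and three_k: "3 * (k * a) = a" for a :: 'a
    using three by (simp_all add: k_def)
  let ?b = "half_trace_half z s t x y (x1_sharp z s t u p x y) (x2_sharp z s t u p x y)
         (y1_sharp z s t u p x y) (y2_sharp z s t u p x y)"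
  let ?q = "trace_zero z s t p (p1_sharp z s t u p x y) (p2_sharp z s t u p x y)
         (p3_sharp z s t u p x y) (p4_sharp z s t u p x y)"
  \<comment> \<open>With opaque names for the long factors, collecting the constant is a small computation.\<close>
  have collect: "2 * k * a1 * b1 + 2 * k * a2 * b2 + 2 * k * a3 * b3 + 2 * k * a4 * b4 + k * u * v
      + k * c1 * d1 + 2 * k * c3 * d3 + k * c2 * d2 + k * c4 * d4
    = k * (2 * (a1 * b1 + a2 * b2 + a3 * b3 + a4 * b4) + u * v
      + (c1 * d1 + 2 * c3 * d3 + c2 * d2 + c4 * d4))"
    for a1 a2 a3 a4 b1 b2 b3 b4 u v c1 c2 c3 c4 d1 d2 d3 d4 :: 'a
    by (simp add: algebra_simps)
  have "N_Upsilon z s t u p x y = k * (2 * ?b + u * u_sharp z s t u p x y + ?q)"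
    unfolding N_Upsilon_def k half_trace_half_def trace_zero_def by (rule collect)
  then have "3 * N_Upsilon z s t u p x y = 2 * ?b + u * u_sharp z s t u p x y + ?q"
    by (simp only: three_k)
  also have "\<dots> = 3 * norm_formula z s t u p x y"
    unfolding half_trace_half_sharp trace_zero_sharp[of z s t p u] norm_formula_def
    by (simp add: algebra_simps)
  finally show ?thesis using three by simp
qed

text \<open>
  The formula is polymorphic over commutative rings, so the polynomial is the value of the formula
  at the indeterminates.
\<close>
definition norm_int_poly :: "(upsilon_var \<Rightarrow>\<^sub>0 nat) \<Rightarrow>\<^sub>0 int" where
  "norm_int_poly = norm_formula (indeterminate VZ) (\<lambda>i. indeterminate (VS i))
     (\<lambda>i. indeterminate (VT i)) (indeterminate VU) (\<lambda>i. indeterminate (VP i))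
     (\<lambda>i. indeterminate (VX i)) (\<lambda>i. indeterminate (VY i))"

lemma eval_norm_int_poly:
  "eval_int_poly norm_int_poly (assignment z s t u p x y) = norm_formula z s t u p x y"
  unfolding norm_int_poly_def norm_formula_def trace_zero_def formula_defs
  by (simp add: eval_int_poly_hom)

section \<open>Bilinear consequences of the axioms\<close>

context cubic_jordan_algebra
begin

text \<open>
  A choice of trilinear form with the norm as its diagonal. It need not be symmetric: in
  characteristics 2 and 3 a cubic form may have no symmetric kernel. Only its symmetrisations
  \<open>norm_deriv\<close> and \<open>norm_polar\<close>, which are the polarisations of the norm, enter below.
\<close>
definition cubic_kernel :: "'b \<Rightarrow> 'b \<Rightarrow> 'b \<Rightarrow> 'a" where
  "cubic_kernel = (SOME M.
     (\<forall>y z. Vector_Spaces.linear scale (*) (\<lambda>x. M x y z)) \<and>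
     (\<forall>x z. Vector_Spaces.linear scale (*) (\<lambda>y. M x y z)) \<and>
     (\<forall>x y. Vector_Spaces.linear scale (*) (\<lambda>z. M x y z)) \<and>
     (\<forall>x. N x = M x x x))"

lemma cubic_kernel_linear:
  "Vector_Spaces.linear scale (*) (\<lambda>x. cubic_kernel x y w)"
  "Vector_Spaces.linear scale (*) (\<lambda>x. cubic_kernel y x w)"
  "Vector_Spaces.linear scale (*) (\<lambda>x. cubic_kernel y w x)"
  and N_eq_cubic_kernel: "N x = cubic_kernel x x x"
  using someI_ex[OF cubic_form[unfolded cubic_form_def], folded cubic_kernel_def] by blast+

lemma cubic_kernel_add:
  "cubic_kernel (x + x') y w = cubic_kernel x y w + cubic_kernel x' y w"
  "cubic_kernel y (x + x') w = cubic_kernel y x w + cubic_kernel y x' w"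
  "cubic_kernel y w (x + x') = cubic_kernel y w x + cubic_kernel y w x'"
  using cubic_kernel_linear[THEN Vector_Spaces.linear.axioms(3), THEN module_hom.add] by auto

lemma cubic_kernel_scale:
  "cubic_kernel (c *s x) y w = c * cubic_kernel x y w"
  "cubic_kernel y (c *s x) w = c * cubic_kernel y x w"
  "cubic_kernel y w (c *s x) = c * cubic_kernel y w x"
  using cubic_kernel_linear[THEN Vector_Spaces.linear.axioms(3), THEN module_hom.scale] by auto

definition norm_deriv :: "'b \<Rightarrow> 'b \<Rightarrow> 'a" where
  "norm_deriv x y = cubic_kernel y x x + cubic_kernel x y x + cubic_kernel x x y"

definition norm_polar :: "'b \<Rightarrow> 'b \<Rightarrow> 'b \<Rightarrow> 'a" where
  "norm_polar x y w = cubic_kernel x y w + cubic_kernel x w y + cubic_kernel y x w + cubic_kernel y w x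
     + cubic_kernel w x y + cubic_kernel w y x"

lemma dir_deriv_norm: "dir_deriv scale y N x = norm_deriv x y"
proof -
  have "N (x + t *s y) = poly [:N x, norm_deriv x y, norm_deriv y x, N y:] t" for t
    by (simp add: N_eq_cubic_kernel norm_deriv_def cubic_kernel_add cubic_kernel_scale algebra_simps)
  then show ?thesis
    using dir_deriv_eq_coeff[of N x scale y "[:N x, norm_deriv x y, norm_deriv y x, N y:]"]
    by simp
qed

lemma T_eq_polar: "T x y = norm_deriv one x * norm_deriv one y - norm_polar one x y"
proof -
  have *: "dir_deriv scale y N = (\<lambda>w. norm_deriv w y)"
    by (rule ext) (rule dir_deriv_norm)
  have "norm_deriv (one + t *s x) y
      = poly [:norm_deriv one y, norm_polar one x y, norm_deriv x y:] t" for t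
    by (simp add: norm_deriv_def norm_polar_def cubic_kernel_add cubic_kernel_scale algebra_simps)
  then have "dir_deriv scale x (\<lambda>w. norm_deriv w y) one = norm_polar one x y"
    using dir_deriv_eq_coeff[of "\<lambda>w. norm_deriv w y" one scale x
        "[:norm_deriv one y, norm_polar one x y, norm_deriv x y:]"] by simp
  then show ?thesis by (simp add: T_def * dir_deriv_norm)
qed

lemma T_commute: "T x y = T y x"
  by (simp add: T_eq_polar norm_polar_def algebra_simps)

lemma T_add: "T (x + x') y = T x y + T x' y" "T y (x + x') = T y x + T y x'"
  by (simp_all add: T_eq_polar norm_polar_def norm_deriv_def cubic_kernel_add algebra_simps)

lemma T_scale: "T (c *s x) y = c * T x y" "T y (c *s x) = c * T y x"
  by (simp_all add: T_eq_polar norm_polar_def norm_deriv_def cubic_kernel_scale algebra_simps)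

lemma T_zero: "T 0 y = 0" "T y 0 = 0"
  using T_scale[where c = 0] by simp_all

lemma T_minus: "T (- x) y = - T x y" "T y (- x) = - T y x"
  using T_scale[where c = "-1"] by simp_all

lemma T_diff: "T (x - x') y = T x y - T x' y" "T y (x - x') = T y x - T y x'"
  using T_add[where x' = "- x'"] by (simp_all add: T_minus)

lemmas T_simps = T_add T_scale T_zero T_minus T_diff

lemma norm_deriv_sharp: "norm_deriv x y = T (sharp x) y"
  by (metis dir_deriv_norm trace_sharp)

lemma norm_add: "N (x + y) = N x + T (sharp x) y + T x (sharp y) + N y"
  by (simp add: N_eq_cubic_kernel norm_deriv_def cubic_kernel_add T_commute[of x]
      flip: norm_deriv_sharp)

lemma norm_polar_cross: "norm_polar x y w = T (x \<sharp> y) w"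
  unfolding cross_def T_diff norm_deriv_sharp[symmetric]
  by (simp add: norm_deriv_def norm_polar_def cubic_kernel_add)

text \<open>
  Both sides are the full polarisation of the norm, which is symmetric in its three arguments.
\<close>
lemma T_cross_assoc: "T (x \<sharp> y) w = T x (y \<sharp> w)"
  unfolding T_commute[of x] norm_polar_cross[symmetric] by (simp add: norm_polar_def)

lemma cross_linear:
  "Vector_Spaces.linear scale scale (\<lambda>x. x \<sharp> y)"
  "Vector_Spaces.linear scale scale (\<lambda>y. x \<sharp> y)"
  using quadratic_sharp unfolding quadratic_map_def cross_def by blast+

lemma cross_add: "(x + x') \<sharp> y = x \<sharp> y + x' \<sharp> y" "y \<sharp> (x + x') = y \<sharp> x + y \<sharp> x'"
  using cross_linear[THEN Vector_Spaces.linear.axioms(3), THEN module_hom.add] by auto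

lemma cross_scale: "(c *s x) \<sharp> y = c *s (x \<sharp> y)" "y \<sharp> (c *s x) = c *s (y \<sharp> x)"
  using cross_linear[THEN Vector_Spaces.linear.axioms(3), THEN module_hom.scale] by auto

lemma cross_zero: "0 \<sharp> y = 0" "y \<sharp> 0 = 0"
  using cross_scale[where c = 0] by simp_all

lemma cross_minus: "(- x) \<sharp> y = - (x \<sharp> y)" "y \<sharp> (- x) = - (y \<sharp> x)"
  using cross_scale[where c = "-1"] by simp_all

lemma cross_diff: "(x - x') \<sharp> y = x \<sharp> y - x' \<sharp> y" "y \<sharp> (x - x') = y \<sharp> x - y \<sharp> x'"
  using cross_add[where x' = "- x'"] by (simp_all add: cross_minus)

lemmas cross_simps = cross_add cross_scale cross_zero cross_minus cross_diff

lemma cross_commute: "x \<sharp> y = y \<sharp> x"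
  by (simp add: cross_def algebra_simps)

lemma sharp_scale: "sharp (c *s x) = c\<^sup>2 *s sharp x"
  using quadratic_sharp by (simp add: quadratic_map_def)

lemma sharp_zero: "sharp 0 = 0"
  using sharp_scale[of 0] by simp

lemma sharp_add: "sharp (x + y) = sharp x + sharp y + x \<sharp> y"
  by (simp add: cross_def)

lemma scale_two: "2 *s v = v + v"
  using scale_left_distrib[of 1 1 v] by simp

lemma cross_self: "x \<sharp> x = 2 *s sharp x"
proof -
  have "4 *s sharp x = sharp (x + x)"
    using sharp_scale[of 2 x] by (simp add: scale_two)
  also have "\<dots> = 2 *s sharp x + x \<sharp> x"
    by (simp only: sharp_add[of x x] scale_two)
  also have "4 *s sharp x = 2 *s sharp x + 2 *s sharp x"
    using scale_left_distrib[of 2 2 "sharp x"] by simp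
  finally show ?thesis by simp
qed

lemma trace_add: "trace (x + y) = trace x + trace y"
  and trace_scale: "trace (c *s x) = c * trace x"
  and trace_minus: "trace (- x) = - trace x"
  and trace_diff: "trace (x - y) = trace x - trace y"
  by (simp_all add: trace_def T_simps)

lemmas trace_simps = trace_add trace_scale trace_minus trace_diff

lemma trace_one: "trace one = 3"
  using norm_one
  by (simp add: trace_def T_eq_polar norm_deriv_def norm_polar_def flip: N_eq_cubic_kernel)

lemma trace_cross: "trace (x \<sharp> y) = trace x * trace y - T x y"
  using unit_sharp[of y] T_cross_assoc[of x y one]
  by (simp add: trace_def T_simps cross_commute[of y])

lemma S_cross: "S2 x y = trace (x \<sharp> y)"
  by (simp add: S2_def S_def sharp_add trace_simps)

lemma S_scale: "S (c *s x) = c\<^sup>2 * S x"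
  by (simp add: S_def sharp_scale trace_simps)

lemma S_add: "S (x + y) = S x + S y + S2 x y"
  by (simp add: S2_def)

end

section \<open>Linearisations of the adjoint identity\<close>

locale nondegenerate_cubic = cubic_jordan_algebra +
  assumes trace_nondegenerate: trace_nondegenerate
begin

lemma eq_if_T_eq:
  assumes "\<And>w. T x w = T y w"
  shows "x = y"
proof -
  have "T (x - y) w = 0" for w by (simp add: T_simps assms)
  then have "x - y = 0" using trace_nondegenerate unfolding trace_nondegenerate_def by blast
  then show ?thesis by simp
qed

text \<open>
  Compare the coefficients of \<open>t\<close> and of \<open>t\<^sup>2\<close> in the adjoint identity at \<open>x + t y\<close>. Nondegeneracy of the
  trace form turns this comparison of vectors into one of scalar polynomials.
\<close>
lemma adjoint_linearized:
  "sharp x \<sharp> (x \<sharp> y) = N x *s y + T (sharp x) y *s x" (is "?l1 = ?r1")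
  "sharp x \<sharp> sharp y + sharp (x \<sharp> y) = T (sharp x) y *s y + T x (sharp y) *s x" (is "?l2 = ?r2")
proof -
  define l where "l w = [:T (sharp (sharp x)) w, T ?l1 w, T ?l2 w,
    T ((x \<sharp> y) \<sharp> sharp y) w, T (sharp (sharp y)) w:]" for w
  define r where "r w = [:N x * T x w, T ?r1 w, T ?r2 w,
    N y * T x w + T x (sharp y) * T y w, N y * T y w:]" for w
  have "poly (l w) t = T (sharp (sharp (x + t *s y))) w" for t w
    by (simp add: l_def sharp_add sharp_scale cross_simps cross_commute T_simps algebra_simps
        power2_eq_square power4_eq_xxxx)
  moreover have "poly (r w) t = T (N (x + t *s y) *s (x + t *s y)) w" for t w
  proof -
    have "N (t *s y) = t ^ 3 * N y"
      by (simp add: N_eq_cubic_kernel cubic_kernel_scale power3_eq_cube)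
    then show ?thesis
      by (simp add: r_def norm_add sharp_scale T_simps algebra_simps
          power2_eq_square power3_eq_cube)
  qed
  ultimately have "poly (l w) t = poly (r w) t" for t w
    by (simp add: adjoint_identity l_def)
  then have "l w = r w" for w by (rule poly_eq_if_eval_eq)
  then have "T ?l1 w = T ?r1 w \<and> T ?l2 w = T ?r2 w" for w by (simp add: l_def r_def)
  then show "?l1 = ?r1" "?l2 = ?r2" by (auto intro: eq_if_T_eq)
qed

text \<open>
  The coefficient of \<open>t\<close> in the first of the preceding identities at \<open>x + t w\<close>.
\<close>
lemma adjoint_bilinearized:
  "(x \<sharp> w) \<sharp> (x \<sharp> y) + sharp x \<sharp> (w \<sharp> y)
     = T (sharp x) w *s y + T (x \<sharp> w) y *s x + T (sharp x) y *s w" (is "?l = ?r")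
proof -
  define R where "R x = N x *s y + T (sharp x) y *s x" for x
  define q where "q v = [:T (R x) v, T ?l v, T ((x \<sharp> w) \<sharp> (w \<sharp> y) + sharp w \<sharp> (x \<sharp> y)) v,
     T (R w) v:]" for v
  define r where "r v = [:T (R x) v, T ?r v,
     T x (sharp w) * T y v + T (x \<sharp> w) y * T w v + T (sharp w) y * T x v,
     T (R w) v:]" for v
  have "poly (q v) t = T (sharp (x + t *s w) \<sharp> ((x + t *s w) \<sharp> y)) v" for t v
    by (simp add: q_def R_def flip: adjoint_linearized)
      (simp add: sharp_add sharp_scale cross_simps T_simps algebra_simps power2_eq_square)
  moreover have "poly (r v) t = T (R (x + t *s w)) v" for t v
  proof -
    have "N (t *s w) = t ^ 3 * N w"
      by (simp add: N_eq_cubic_kernel cubic_kernel_scale power3_eq_cube)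
    then show ?thesis
      by (simp add: r_def R_def norm_add sharp_add sharp_scale T_simps cross_simps algebra_simps
          power2_eq_square power3_eq_cube)
  qed
  ultimately have "poly (q v) t = poly (r v) t" for t v
    by (simp add: adjoint_linearized R_def)
  then have "q v = r v" for v by (rule poly_eq_if_eval_eq)
  then have "T ?l v = T ?r v" for v by (simp add: q_def r_def)
  then show ?thesis by (rule eq_if_T_eq)
qed

lemma adjoint_trilinearized:
  "(x \<sharp> w) \<sharp> (v \<sharp> y) + (v \<sharp> w) \<sharp> (x \<sharp> y) + (x \<sharp> v) \<sharp> (w \<sharp> y)
     = T (x \<sharp> v) w *s y + T (x \<sharp> w) y *s v + T (v \<sharp> w) y *s x + T (x \<sharp> v) y *s w"
    (is "?l = ?r")
proof -
  define d where "d x = (x \<sharp> w) \<sharp> (x \<sharp> y) + sharp x \<sharp> (w \<sharp> y)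
     - (T (sharp x) w *s y + T (x \<sharp> w) y *s x + T (sharp x) y *s w)" for x
  have "?l - ?r = d (x + v) - d x - d v"
    unfolding d_def by (simp add: cross_commute[of v x] sharp_add cross_simps T_simps algebra_simps)
  moreover have "d x = 0" for x
    by (simp add: d_def adjoint_bilinearized)
  ultimately show ?thesis by simp
qed

lemma trace_eq_norm_deriv: "trace x = norm_deriv one x"
  using norm_one
  by (simp add: trace_def T_eq_polar norm_deriv_def norm_polar_def algebra_simps
      flip: N_eq_cubic_kernel)

lemma T_one: "T one y = trace y" "T y one = trace y"
  by (simp_all add: trace_def T_commute[of one])

lemma trace_zero: "trace 0 = 0"
  by (simp add: trace_def T_zero)

lemma cross_one: "one \<sharp> y = trace y *s one - y" "y \<sharp> one = trace y *s one - y"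
  using unit_sharp[of y] cross_commute[of y one] by simp_all

lemma sharp_one: "sharp one = one"
proof (rule eq_if_T_eq)
  show "T (sharp one) w = T one w" for w
    using trace_eq_norm_deriv[of w] by (simp add: norm_deriv_sharp trace_def T_commute)
qed

end

section \<open>The Peirce decomposition of a primitive idempotent\<close>

locale primitive_cubic = nondegenerate_cubic +
  fixes e :: 'b
  assumes primitive_e: "primitive_idempotent e"
begin

abbreviation f :: 'b where "f \<equiv> one - e"

lemma sharp_e: "sharp e = 0"
  using primitive_e by (simp add: primitive_idempotent_def)

lemma e_nonzero: "e \<noteq> 0"
  using primitive_e by (simp add: primitive_idempotent_def idempotent_def)

lemma trace_e: "trace e = 1"
proof -
  have "trace e *s e = 1 *s e"
    using primitive_e
    unfolding primitive_idempotent_def idempotent_def U_def trace_def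
    by (metis cross_zero(1) diff_zero scale_one)
  then show ?thesis using e_nonzero by (simp only: scale_right_imp_eq)
qed

lemma cross_e_e: "e \<sharp> e = 0"
  by (simp add: cross_self sharp_e)

lemma T_e_e: "T e e = 1"
  using trace_cross[of e e] by (simp add: cross_e_e trace_e trace_zero)

lemma T_f: "T f y = trace y - T e y"
  by (simp add: T_simps T_one)

lemma cross_e_f: "e \<sharp> f = f"
  by (simp add: cross_simps cross_one cross_e_e trace_e)

lemma sharp_f: "sharp f = e"
proof -
  have "sharp f = sharp (one + (-1) *s e)" by simp
  also have "\<dots> = e"
    unfolding sharp_add sharp_scale cross_simps cross_one
    by (simp add: sharp_one sharp_e trace_e)
  finally show ?thesis .
qed

lemma cross_f: "f \<sharp> y = trace y *s one - y - e \<sharp> y"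
  by (simp add: cross_simps cross_one)

lemma trace_cross_e: "trace (e \<sharp> y) = trace y - T e y"
  by (simp add: trace_cross trace_e)

lemma T_e_cross_e: "T e (e \<sharp> y) = 0"
  by (simp add: cross_e_e T_zero flip: T_cross_assoc)

text \<open>
  Multiplication by \<open>e\<close> is an involution on \<open>J\<^sub>0\<close>, fixing \<open>f\<close> and negating the elements of trace zero, and
  it annihilates \<open>J\<^sub>1\<close> and \<open>J\<^bsub>1/2\<^esub>\<close>. Its square is therefore the projection to \<open>J\<^sub>0\<close>. This is what makes the
  Peirce spaces computable.
\<close>
lemma cross_e_cross_e: "e \<sharp> (e \<sharp> y) = T f y *s f - e \<sharp> y"
proof -
  have "f \<sharp> (e \<sharp> y) = T f y *s e"
    using adjoint_bilinearized[of e one y]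
    by (simp add: sharp_e cross_zero T_zero cross_one trace_e)
  then show ?thesis
    by (simp add: cross_f trace_cross_e T_f algebra_simps)
qed

lemma U_f: "U f y = e \<sharp> (e \<sharp> y)"
  by (simp add: U_def sharp_f cross_e_cross_e)

lemma U2_e_f: "U2 e f y = T e y *s f + T f y *s e - f \<sharp> y"
  by (simp add: U2_def U_def sharp_one sharp_f sharp_e cross_zero algebra_simps)
     (simp add: T_simps cross_simps cross_one T_one algebra_simps)

lemma peirce_zero_iff:
  "a \<in> peirce_zero e \<longleftrightarrow> T e a = 0 \<and> e \<sharp> a = trace a *s f - a" (is "?l \<longleftrightarrow> ?r")
proof
  assume ?l
  then obtain y where a: "a = e \<sharp> (e \<sharp> y)" by (auto simp: peirce_zero_def U_f)
  then have T: "T e a = 0" by (simp add: T_e_cross_e)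
  have "e \<sharp> a = T f (e \<sharp> y) *s f - a"
    unfolding a by (rule cross_e_cross_e)
  then show ?r using T by (simp add: T_f T_e_cross_e a trace_cross_e)
next
  assume r: ?r
  have "U f a = T f a *s f - e \<sharp> a" by (simp only: U_f cross_e_cross_e)
  with r have "U f a = a" by (simp add: T_f)
  then show ?l unfolding peirce_zero_def by (metis rangeI)
qed

lemma peirce_half_iff:
  "h \<in> peirce_half e \<longleftrightarrow> T e h = 0 \<and> trace h = 0 \<and> e \<sharp> h = 0" (is "?l \<longleftrightarrow> ?r")
proof
  assume ?l
  then obtain y where h: "h = T e y *s f + T f y *s e - f \<sharp> y"
    by (auto simp: peirce_half_def U2_e_f)
  show ?r unfolding h
    by (simp add: T_simps cross_simps trace_simps trace_e trace_one cross_f cross_e_cross_e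
        T_e_e T_one T_f cross_one cross_e_e T_e_cross_e trace_cross_e algebra_simps)
next
  assume r: ?r
  then have "U2 e f h = h"
    by (simp add: U2_e_f cross_f T_f)
  then show ?l unfolding peirce_half_def by (metis rangeI)
qed

lemma subspace_peirce_zero: "subspace (peirce_zero e)"
proof (rule subspaceI)
  show "0 \<in> peirce_zero e" by (simp add: peirce_zero_iff T_zero trace_zero cross_zero)
  show "x + y \<in> peirce_zero e" if "x \<in> peirce_zero e" "y \<in> peirce_zero e" for x y
    using that by (simp add: peirce_zero_iff T_add trace_add cross_add scale_left_distrib)
  show "c *s x \<in> peirce_zero e" if "x \<in> peirce_zero e" for c x
    using that by (simp add: peirce_zero_iff T_scale trace_scale cross_scale
        scale_right_diff_distrib)
qed

lemma subspace_peirce_half: "subspace (peirce_half e)"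
  by (rule subspaceI)
    (auto simp: peirce_half_iff T_simps trace_simps cross_simps trace_zero)

lemma f_in_peirce_zero: "f \<in> peirce_zero e"
  by (simp add: peirce_zero_iff cross_e_f trace_simps trace_e trace_one T_simps T_e_e T_one
      scale_two)

lemma cross_e_involution:
  assumes "a \<in> peirce_zero e"
  shows "e \<sharp> (e \<sharp> a) = a" "e \<sharp> a \<in> peirce_zero e"
proof -
  have "e \<sharp> (e \<sharp> a) = T f a *s f - e \<sharp> a" by (rule cross_e_cross_e)
  then show *: "e \<sharp> (e \<sharp> a) = a"
    using assms by (simp add: peirce_zero_iff T_f)
  have "e \<sharp> a = U f (e \<sharp> a)" by (simp add: U_f *)
  then show "e \<sharp> a \<in> peirce_zero e" unfolding peirce_zero_def by (rule range_eqI)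
qed

lemma T_zero_half:
  assumes "a \<in> peirce_zero e" "h \<in> peirce_half e"
  shows "T a h = 0"
proof -
  have "T a h = T (e \<sharp> (e \<sharp> a)) h" by (simp add: cross_e_involution assms)
  also have "\<dots> = T (e \<sharp> a) (e \<sharp> h)"
    by (simp add: T_cross_assoc cross_commute[of e "e \<sharp> a"])
  finally show ?thesis using assms by (simp add: peirce_half_iff T_zero)
qed

text \<open>
  For \<open>b = e \<sharp> a\<close> the second linearised identity at \<open>(e, b)\<close> reads \<open>(e \<sharp> b)\<^sup>\<sharp> = T(e, b\<^sup>\<sharp>) e\<close>, and \<open>e \<sharp> b = a\<close>.
\<close>
lemma sharp_peirce_zero:
  assumes "a \<in> peirce_zero e"
  shows "sharp a = S a *s e"
proof -
  let ?b = "e \<sharp> a"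
  have "sharp (e \<sharp> ?b) = T e (sharp ?b) *s e"
    using adjoint_linearized(2)[of e ?b] by (simp add: sharp_e cross_zero T_zero)
  then have *: "sharp a = T e (sharp ?b) *s e" by (simp add: cross_e_involution assms)
  then have "S a = T e (sharp ?b)" by (simp add: S_def trace_simps trace_e)
  with * show ?thesis by simp
qed

text \<open>
  The bilinearised identity at \<open>x = h\<close>, \<open>w = e\<close>, \<open>y = 1\<close> computes \<open>h\<^sup>\<sharp> \<sharp> f\<close>, which is equivalent to the defining
  property of \<open>J\<^sub>0\<close>.
\<close>
lemma sharp_peirce_half:
  assumes h: "h \<in> peirce_half e"
  shows "sharp h \<in> peirce_zero e"
proof -
  have "T e (sharp h) *s e = 0"
    using adjoint_linearized(2)[of e h] h
    by (simp add: sharp_e cross_zero T_zero peirce_half_iff sharp_zero)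
  then have T: "T e (sharp h) = 0" using e_nonzero by simp
  have "sharp h \<sharp> f = trace (sharp h) *s e"
    using adjoint_bilinearized[of h e one] h T
    by (simp add: peirce_half_iff cross_one cross_commute[of h e] trace_e cross_zero T_zero
        T_commute[of "sharp h" e] T_one trace_zero)
  then show ?thesis
    using T by (simp add: peirce_zero_iff cross_commute[of "sharp h" f] cross_f algebra_simps)
qed

lemma f_cross_half:
  assumes "h \<in> peirce_half e"
  shows "f \<sharp> h = - h"
  using assms by (simp add: cross_f peirce_half_iff)

text \<open>
  This is \<open>J\<^sub>0 \<inter> f\<^sup>\<bottom>\<close>, the space that carries the Clifford action on \<open>J\<^bsub>1/2\<^esub>\<close>.
\<close>
definition traceless_zero :: "'b set" where
  "traceless_zero = {a \<in> peirce_zero e. trace a = 0}"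

lemma traceless_zero_iff:
  "a \<in> traceless_zero \<longleftrightarrow> T e a = 0 \<and> trace a = 0 \<and> e \<sharp> a = - a"
  by (auto simp: traceless_zero_def peirce_zero_iff)

lemma traceless_zeroD:
  assumes "a \<in> traceless_zero"
  shows "a \<in> peirce_zero e" "T e a = 0" "trace a = 0" "e \<sharp> a = - a" "f \<sharp> a = 0" "T f a = 0"
  using assms by (auto simp: traceless_zero_def peirce_zero_iff cross_f T_f)

text \<open>
  The trilinearised identity at \<open>1, e, a, h\<close> gives \<open>f \<sharp> (a \<sharp> h) = - a \<sharp> h\<close>, all other terms being killed by
  orthogonality; comparing with \<open>f \<sharp> b = T(b) 1 - b - e \<sharp> b\<close> shows that \<open>e\<close> annihilates \<open>a \<sharp> h\<close>.
\<close>
lemma traceless_zero_cross_half: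
  assumes a: "a \<in> traceless_zero" and h: "h \<in> peirce_half e"
  shows "a \<sharp> h \<in> peirce_half e"
proof -
  note [simp] = traceless_zeroD[OF a]
  have [simp]: "T e h = 0" "trace h = 0" "e \<sharp> h = 0"
    using h by (auto simp: peirce_half_iff)
  have [simp]: "T a h = 0" using T_zero_half a h by (simp add: traceless_zero_def)
  have [simp]: "T a e = 0" "T h e = 0" "T h a = 0"
    by (simp_all add: T_commute[of _ e] T_commute[of h a])
  have tr: "trace (a \<sharp> h) = 0" by (simp add: trace_cross)
  have te: "T e (a \<sharp> h) = 0"
    by (simp add: T_minus flip: T_cross_assoc)
  have "f \<sharp> (a \<sharp> h) + a \<sharp> h = 0"
    using adjoint_trilinearized[of one e a h]
    by (simp add: cross_one cross_commute[of a e] cross_simps T_simps T_one trace_e)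
  then have "e \<sharp> (a \<sharp> h) = 0"
    by (simp add: cross_f tr)
  with tr te show ?thesis by (simp add: peirce_half_iff)
qed

text \<open>
  The bilinearised identity at \<open>x = a\<close>, \<open>w = 1\<close>, \<open>y = h\<close>: here \<open>a \<sharp> 1 = - a\<close>, the summand
  \<open>a\<^sup>\<sharp> \<sharp> (1 \<sharp> h)\<close> vanishes because \<open>a\<^sup>\<sharp>\<close> is a multiple of \<open>e\<close>, and the only surviving term on the right
  is \<open>T(a\<^sup>\<sharp>, 1) h = S(a) h\<close>.
\<close>
lemma clifford_relation:
  assumes a: "a \<in> traceless_zero" and h: "h \<in> peirce_half e"
  shows "a \<sharp> (a \<sharp> h) = - (S a *s h)"
proof -
  note [simp] = traceless_zeroD[OF a]
  have [simp]: "trace h = 0" "e \<sharp> h = 0" using h by (auto simp: peirce_half_iff)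
  have [simp]: "T a h = 0" using T_zero_half a h by (simp add: traceless_zero_def)
  have [simp]: "T e h = 0" using h by (auto simp: peirce_half_iff)
  have "- (a \<sharp> (a \<sharp> h)) = S a *s h"
    using adjoint_bilinearized[of a one h]
    by (simp add: cross_one cross_simps sharp_peirce_zero T_simps T_one trace_e trace_scale)
  then show ?thesis by (metis minus_minus)
qed

lemma clifford_relation_polarized:
  assumes "a \<in> traceless_zero" "b \<in> traceless_zero" and h: "h \<in> peirce_half e"
  shows "a \<sharp> (b \<sharp> h) + b \<sharp> (a \<sharp> h) = - (S2 a b *s h)"
proof -
  have "a + b \<in> traceless_zero" using assms
    by (simp add: traceless_zero_iff T_simps cross_simps trace_simps)
  from clifford_relation[OF this h] show ?thesis
    using clifford_relation[OF assms(1) h] clifford_relation[OF assms(2) h]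
    by (simp add: cross_add S_add eq_neg_iff_add_eq_0 algebra_simps)
qed

end

section \<open>Self-adjointness determines the form on the half space\<close>

text \<open>
  The families in a frame are indexed by the numerals \<open>1, \<dots>, 4\<close>, and rewriting \<open>1\<close> to \<open>Suc 0\<close> would
  separate \<open>\<pi> 1\<close> from the facts about it.
\<close>

declare One_nat_def [simp del]

text \<open>
  Let \<open>a\<close> act on \<open>V\<close> by \<open>\<psi>\<^sub>1 \<mapsto> - r\<^sub>3\<psi>\<^sub>1 + r\<^sub>2\<psi>\<^sub>2\<close> and \<open>\<psi>\<^sub>2 \<mapsto> - r\<^sub>4\<psi>\<^sub>1 + r\<^sub>3\<psi>\<^sub>2\<close>, with \<open>S(\<pi>\<^sub>1, a) = r\<^sub>1\<close>. The
  equations express that \<open>a\<close> is self-adjoint for a symmetric bilinear form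
  with values \<open>b\<^sub>i\<^sub>j\<close> at \<open>(\<psi>\<^sub>i, \<psi>\<^sub>j)\<close> and
  \<open>g\<^sub>i\<^sub>j\<close> at \<open>(\<chi>\<^sub>i, \<psi>\<^sub>j)\<close>; the second array is symmetric because \<open>\<pi>\<^sub>1\<close>
  is self-adjoint as well.
\<close>
definition self_adjoint_eqs ::
    "(nat \<Rightarrow> 'a::comm_ring_1) \<Rightarrow> 'a \<Rightarrow> 'a \<Rightarrow> 'a \<Rightarrow> 'a \<Rightarrow> 'a \<Rightarrow> 'a \<Rightarrow> bool" where
  "self_adjoint_eqs r b11 b12 b22 g11 g12 g22 \<longleftrightarrow>
     r 4 * b11 - 2 * r 3 * b12 + r 2 * b22 = 0 \<and>
     r 1 * b11 + 2 * r 3 * g11 - 2 * r 2 * g12 = 0 \<and>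
     r 1 * b12 + r 4 * g11 - r 2 * g22 = 0 \<and>
     r 1 * b22 + 2 * r 4 * g12 - 2 * r 3 * g22 = 0"

text \<open>
  The first equations for \<open>s\<close> and \<open>t\<close> force \<open>(b\<^sub>1\<^sub>1, b\<^sub>1\<^sub>2, b\<^sub>2\<^sub>2)\<close> to be a multiple of a cross product, and
  the others then give \<open>g\<close>. If the cross product vanishes, that is, if \<open>s\<close> and \<open>t\<close> are proportional in
  the indices 2, 3, 4, then \<open>V\<close> is isotropic and the scalar is read off from \<open>g\<close> instead.
\<close>
lemma self_adjoint_unique:
  fixes s t :: "nat \<Rightarrow> 'a::field"
  assumes two: "(2::'a) \<noteq> 0"
    and nz: "s 2 \<noteq> 0" "s 3 \<noteq> 0" "s 4 \<noteq> 0"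
    and indep: "ST s t 1 2 \<noteq> 0 \<or> ST s t 2 3 \<noteq> 0 \<or> ST s t 2 4 \<noteq> 0 \<or> ST s t 3 4 \<noteq> 0"
    and eqs: "self_adjoint_eqs s b11 b12 b22 g11 g12 g22"
      "self_adjoint_eqs t b11 b12 b22 g11 g12 g22"
  shows "\<exists>k. b11 = 2 * k * ST s t 2 3 \<and> b12 = k * ST s t 2 4 \<and> b22 = 2 * k * ST s t 3 4
    \<and> g11 = k * ST s t 1 2 \<and> g12 = k * ST s t 1 3 \<and> g22 = k * ST s t 1 4"
proof -
  note es = eqs(1)[unfolded self_adjoint_eqs_def] and et = eqs(2)[unfolded self_adjoint_eqs_def]
  have bb: "2 * b12 * ST s t 2 3 = b11 * ST s t 2 4" "2 * b12 * ST s t 3 4 = b22 * ST s t 2 4"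
    "b22 * ST s t 2 3 = b11 * ST s t 3 4"
    using es et unfolding ST_def by algebra+
  have bg: "b11 * ST s t 1 2 = 2 * g11 * ST s t 2 3" "b11 * ST s t 1 3 = 2 * g12 * ST s t 2 3"
    "b22 * ST s t 1 4 = 2 * g22 * ST s t 3 4" "b22 * ST s t 1 3 = 2 * g12 * ST s t 3 4"
    using es et unfolding ST_def by algebra+
  consider "ST s t 2 3 \<noteq> 0" | "ST s t 3 4 \<noteq> 0" | "ST s t 2 3 = 0" "ST s t 3 4 = 0" by blast
  then show ?thesis
  proof cases
    case 1
    define k where "k = b11 / (2 * ST s t 2 3)"
    have b11: "b11 = 2 * k * ST s t 2 3" using 1 two by (simp add: k_def)
    have b12: "b12 = k * ST s t 2 4" using bb(1) 1 two by (simp add: k_def field_simps)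
    have b22: "b22 = 2 * k * ST s t 3 4" using bb(3) 1 two by (simp add: k_def field_simps)
    have g11: "g11 = k * ST s t 1 2" using bg(1) 1 two by (simp add: k_def field_simps)
    have g12: "g12 = k * ST s t 1 3" using bg(2) 1 two by (simp add: k_def field_simps)
    have "s 2 * (g22 - k * ST s t 1 4) = 0"
      using es unfolding ST_def b12[unfolded ST_def] g11[unfolded ST_def] by algebra
    then show ?thesis using b11 b12 b22 g11 g12 nz by auto
  next
    case 2
    define k where "k = b22 / (2 * ST s t 3 4)"
    have b22: "b22 = 2 * k * ST s t 3 4" using 2 two by (simp add: k_def)
    have b12: "b12 = k * ST s t 2 4" using bb(2) 2 two by (simp add: k_def field_simps)
    have b11: "b11 = 2 * k * ST s t 2 3" using bb(3) 2 two by (simp add: k_def field_simps)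
    have g22: "g22 = k * ST s t 1 4" using bg(3) 2 two by (simp add: k_def field_simps)
    have g12: "g12 = k * ST s t 1 3" using bg(4) 2 two by (simp add: k_def field_simps)
    have "s 4 * (g11 - k * ST s t 1 2) = 0"
      using es unfolding ST_def b12[unfolded ST_def] g22[unfolded ST_def] by algebra
    then show ?thesis using b11 b12 b22 g22 g12 nz by auto
  next
    case 3
    have "s 3 * ST s t 2 4 = s 2 * ST s t 3 4 + s 4 * ST s t 2 3"
      unfolding ST_def by algebra
    with 3 nz have D2: "ST s t 2 4 = 0" by simp
    with 3 indep have D: "ST s t 1 2 \<noteq> 0" by simp
    have "b11 * ST s t 1 2 = 0" using bg(1) 3 by simp
    then have b11: "b11 = 0" using D by simp
    have "b12 * ST s t 1 2 = 0" using es et D2 unfolding ST_def by algebra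
    then have b12: "b12 = 0" using D by simp
    have b22: "b22 = 0" using es b11 b12 nz by simp
    define k where "k = g11 / ST s t 1 2"
    have g11: "g11 = k * ST s t 1 2" using D by (simp add: k_def)
    have "2 * s 2 * (g12 - k * ST s t 1 3) = 0"
      using es 3 b11 unfolding g11 ST_def by algebra
    moreover have "s 2 * (g22 - k * ST s t 1 4) = 0"
      using es D2 b12 unfolding g11 ST_def by algebra
    ultimately show ?thesis using 3 D2 b11 b12 b22 g11 nz two by auto
  qed
qed

section \<open>The Clifford action in a frame\<close>

locale nondegenerate_frame = peirce_frame +
  assumes trace_nondegenerate: trace_nondegenerate
begin

sublocale primitive_cubic scale N sharp one \<upsilon>
  by unfold_locales (rule trace_nondegenerate, rule primitive)

lemma pi_traceless: "\<pi> 1 \<in> traceless_zero" "\<pi> 2 \<in> traceless_zero" "\<pi> 4 \<in> traceless_zero"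
proof -
  have "{\<pi> 1, \<pi> 2, \<pi> 4} \<subseteq> peirce_zero \<upsilon> \<inter> {x. T x (\<pi> 3) = 0}"
    using pi_basis span_superset[of "{\<pi> 1, \<pi> 2, \<pi> 4}"] by (simp add: basis_of_def)
  moreover have "a \<in> traceless_zero" if "a \<in> peirce_zero \<upsilon>" "T a (\<pi> 3) = 0" for a
    using that
    by (simp add: traceless_zero_def peirce_zero_iff pi3 T_simps T_one T_commute[of a \<upsilon>])
  ultimately show "\<pi> 1 \<in> traceless_zero" "\<pi> 2 \<in> traceless_zero" "\<pi> 4 \<in> traceless_zero"
    by auto
qed

lemma psi_half: "\<psi> 1 \<in> peirce_half \<upsilon>" "\<psi> 2 \<in> peirce_half \<upsilon>"
  using V_half psi_basis span_superset[of "{\<psi> 1, \<psi> 2}"] by (auto simp: basis_of_def)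

lemma chi_half: "\<chi> 1 \<in> peirce_half \<upsilon>" "\<chi> 2 \<in> peirce_half \<upsilon>"
  unfolding chi1 chi2
  by (intro subspace_neg subspace_peirce_half traceless_zero_cross_half pi_traceless psi_half)+

lemma independent_pair:
  assumes "independent A" "v \<in> A" "w \<in> A" "v \<noteq> w" "c1 *s v + c2 *s w = 0"
  shows "c1 = 0" "c2 = 0"
proof -
  define c where "c x = (if x = v then c1 else c2)" for x
  have "(\<Sum>x\<in>{v, w}. c x *s x) = 0" using assms by (simp add: c_def)
  then have "c v = 0 \<and> c w = 0"
    using independentD[of A "{v, w}" c] assms by blast
  then show "c1 = 0" "c2 = 0" using assms(4) by (auto simp: c_def)
qed

lemma psi_independent: "c1 *s \<psi> 1 + c2 *s \<psi> 2 = 0 \<Longrightarrow> c1 = 0 \<and> c2 = 0"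
  using independent_pair[of "{\<psi> 1, \<psi> 2}" "\<psi> 1" "\<psi> 2" c1 c2] psi_basis
  by (simp add: basis_of_def)

lemma pi24_independent: "c1 *s \<pi> 2 + c2 *s \<pi> 4 = 0 \<Longrightarrow> c1 = 0 \<and> c2 = 0"
  using independent_pair[of "{\<pi> 1, \<pi> 2, \<pi> 4}" "\<pi> 2" "\<pi> 4" c1 c2] pi_basis
  by (simp add: basis_of_def)

text \<open>
  In characteristic 2 the vector \<open>\<pi>\<^sub>3\<close> is orthogonal to itself, hence in the span of \<open>\<pi>\<^sub>1, \<pi>\<^sub>2, \<pi>\<^sub>4\<close>, which
  contradicts the linear independence of the frame.
\<close>
lemma two_nonzero: "(2::'a) \<noteq> 0"
proof
  assume two: "(2::'a) = 0"
  have "T (\<pi> 3) (\<pi> 3) = 2"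
    by (simp add: pi3 T_simps T_one trace_simps trace_one trace_e T_e_e)
  then have "\<pi> 3 \<in> span {\<pi> 1, \<pi> 2, \<pi> 4}"
    using pi_basis f_in_peirce_zero two by (simp add: basis_of_def pi3)
  moreover have "{\<pi> 1, \<pi> 2, \<pi> 4} \<subseteq> {\<upsilon>, \<pi> 1, \<pi> 2, \<pi> 3, \<pi> 4, \<psi> 1, \<psi> 2, \<chi> 1, \<chi> 2} - {\<pi> 3}"
    using basis by (auto simp: basis_of_def)
  ultimately have "dependent {\<upsilon>, \<pi> 1, \<pi> 2, \<pi> 3, \<pi> 4, \<psi> 1, \<psi> 2, \<chi> 1, \<chi> 2}"
    unfolding dependent_def using span_mono by blast
  then show False using basis by (simp add: basis_of_def)
qed

lemma eq_if_T_eq_basis: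
  assumes "T x \<upsilon> = T y \<upsilon>"
    and "\<And>i. i \<in> {1,2,3,4} \<Longrightarrow> T x (\<pi> i) = T y (\<pi> i)"
    and "\<And>i. i \<in> {1,2} \<Longrightarrow> T x (\<psi> i) = T y (\<psi> i)"
    and "\<And>i. i \<in> {1,2} \<Longrightarrow> T x (\<chi> i) = T y (\<chi> i)"
  shows "x = y"
proof (rule eq_if_T_eq)
  fix w
  have "w \<in> span {\<upsilon>, \<pi> 1, \<pi> 2, \<pi> 3, \<pi> 4, \<psi> 1, \<psi> 2, \<chi> 1, \<chi> 2}"
    using basis by (simp add: basis_of_def)
  then show "T x w = T y w"
    by (induction rule: span_induct_alt) (use assms in \<open>auto simp: T_simps\<close>)
qed

definition zero_part :: "'a \<Rightarrow> 'a \<Rightarrow> 'a \<Rightarrow> 'a \<Rightarrow> 'b" where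
  "zero_part a1 a2 a3 a4 = a1 *s \<pi> 1 + a2 *s \<pi> 2 + a3 *s \<pi> 3 + a4 *s \<pi> 4"

definition half_part :: "'a \<Rightarrow> 'a \<Rightarrow> 'a \<Rightarrow> 'a \<Rightarrow> 'b" where
  "half_part a1 a2 b1 b2 = a1 *s \<chi> 1 + a2 *s \<chi> 2 + b1 *s \<psi> 1 + b2 *s \<psi> 2"

lemma zero_part_mem: "zero_part a1 a2 a3 a4 \<in> peirce_zero \<upsilon>"
  unfolding zero_part_def
  using pi_traceless f_in_peirce_zero
  by (intro subspace_add subspace_scale subspace_peirce_zero) (auto simp: traceless_zero_def pi3)

lemma half_part_mem: "half_part a1 a2 b1 b2 \<in> peirce_half \<upsilon>"
  unfolding half_part_def
  by (intro subspace_add subspace_scale subspace_peirce_half chi_half psi_half)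

text \<open>
  The parameters \<open>r\<close> determine the action of \<open>a\<close> on all of \<open>J\<^bsub>1/2\<^esub>\<close>. They depend linearly on \<open>a\<close>, and the
  signs in a frame are such that \<open>\<pi>\<^sub>2\<close> has parameters \<open>s\<close> and \<open>- \<pi>\<^sub>4\<close> has parameters \<open>t\<close>. This lets the
  coordinate formulas depend on \<open>p\<^sub>2\<close> and \<open>p\<^sub>4\<close> only through \<open>p\<^sub>2s\<^sub>i - p\<^sub>4t\<^sub>i\<close>.
\<close>
definition acts_by :: "'b \<Rightarrow> (nat \<Rightarrow> 'a) \<Rightarrow> bool" where
  "acts_by a r \<longleftrightarrow> a \<in> traceless_zero \<and> S2 (\<pi> 1) a = r 1
     \<and> a \<sharp> \<psi> 1 = - (r 3 *s \<psi> 1) + r 2 *s \<psi> 2 \<and> a \<sharp> \<psi> 2 = - (r 4 *s \<psi> 1) + r 3 *s \<psi> 2"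

lemma acts_byD:
  assumes "acts_by a r"
  shows "a \<in> traceless_zero" "S2 (\<pi> 1) a = r 1"
    "a \<sharp> \<psi> 1 = - (r 3 *s \<psi> 1) + r 2 *s \<psi> 2" "a \<sharp> \<psi> 2 = - (r 4 *s \<psi> 1) + r 3 *s \<psi> 2"
  using assms by (auto simp: acts_by_def)

lemma acts_by_pi: "acts_by (\<pi> 2) s" "acts_by (- \<pi> 4) t"
  using pi_traceless
  by (simp_all add: acts_by_def s1 t1 pi2_psi1 pi2_psi2 pi4_psi1 pi4_psi2 traceless_zero_iff
      cross_simps T_simps trace_simps S_cross)

lemma acts_by_combination:
  assumes "acts_by a r" "acts_by a' r'"
  shows "acts_by (c *s a + c' *s a') (\<lambda>i. c * r i + c' * r' i)"
proof -
  have "c *s a + c' *s a' \<in> traceless_zero"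
    using assms by (simp add: acts_by_def traceless_zero_iff cross_simps T_simps trace_simps)
  then show ?thesis
    using acts_byD(2)[OF assms(1)] acts_byD(2)[OF assms(2)]
    by (simp add: acts_by_def acts_byD(3,4)[OF assms(1)] acts_byD(3,4)[OF assms(2)]
        S_cross cross_simps trace_simps)
      (simp add: algebra_simps)
qed

lemma pi1_psi: "\<pi> 1 \<sharp> \<psi> 1 = - \<chi> 1" "\<pi> 1 \<sharp> \<psi> 2 = - \<chi> 2"
  by (simp_all add: chi1 chi2)

lemma pi1_chi: "\<pi> 1 \<sharp> \<chi> 1 = - (z *s \<psi> 1)" "\<pi> 1 \<sharp> \<chi> 2 = - (z *s \<psi> 2)"
  using clifford_relation[OF pi_traceless(1) psi_half(1)]
    clifford_relation[OF pi_traceless(1) psi_half(2)]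
  by (simp_all add: chi1 chi2 cross_minus z)

text \<open>
  Evaluate the Clifford relation at \<open>\<psi>\<^sub>1\<close>: a trace zero \<open>2 \<times> 2\<close> matrix squares to minus its determinant.
\<close>
lemma acts_by_S:
  assumes "acts_by a r"
  shows "S a = r 2 * r 4 - (r 3)\<^sup>2"
proof -
  have "a \<sharp> (a \<sharp> \<psi> 1) = ((r 3)\<^sup>2 - r 2 * r 4) *s \<psi> 1"
    by (simp add: acts_byD[OF assms] cross_simps algebra_simps power2_eq_square)
  moreover have "a \<sharp> (a \<sharp> \<psi> 1) = - (S a *s \<psi> 1)"
    using acts_byD(1)[OF assms] psi_half(1) by (rule clifford_relation)
  ultimately have "(S a + (r 3)\<^sup>2 - r 2 * r 4) *s \<psi> 1 + 0 *s \<psi> 2 = 0"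
    by (simp add: algebra_simps)
  then have "S a + (r 3)\<^sup>2 - r 2 * r 4 = 0" using psi_independent by blast
  then show ?thesis by (simp add: algebra_simps)
qed

text \<open>
  Anticommute \<open>a\<close> past \<open>\<pi>\<^sub>1\<close> in \<open>a \<sharp> \<chi>\<^sub>i = - a \<sharp> (\<pi>\<^sub>1 \<sharp> \<psi>\<^sub>i)\<close>.
\<close>
lemma acts_by_chi:
  assumes "acts_by a r"
  shows "a \<sharp> \<chi> 1 = r 1 *s \<psi> 1 + r 3 *s \<chi> 1 - r 2 *s \<chi> 2"
    and "a \<sharp> \<chi> 2 = r 1 *s \<psi> 2 + r 4 *s \<chi> 1 - r 3 *s \<chi> 2"
proof -
  have anti: "a \<sharp> (\<pi> 1 \<sharp> h) = - (r 1 *s h) - \<pi> 1 \<sharp> (a \<sharp> h)" if "h \<in> peirce_half \<upsilon>" for h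
    using clifford_relation_polarized[OF pi_traceless(1) _ that, of a] acts_byD[OF assms]
    by (simp add: algebra_simps eq_neg_iff_add_eq_0)
  show "a \<sharp> \<chi> 1 = r 1 *s \<psi> 1 + r 3 *s \<chi> 1 - r 2 *s \<chi> 2"
    by (simp add: chi1 chi2 cross_minus anti psi_half acts_byD[OF assms])
      (simp add: cross_simps algebra_simps)
  show "a \<sharp> \<chi> 2 = r 1 *s \<psi> 2 + r 4 *s \<chi> 1 - r 3 *s \<chi> 2"
    by (simp add: chi1 chi2 cross_minus anti psi_half acts_byD[OF assms])
      (simp add: cross_simps algebra_simps)
qed

lemma T_self_adjoint: "T (a \<sharp> x) y = T x (a \<sharp> y)"
  by (metis T_cross_assoc cross_commute)

lemma T_chi_psi_commute: "T (\<chi> 2) (\<psi> 1) = T (\<chi> 1) (\<psi> 2)"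
  unfolding chi1 chi2 T_minus using T_self_adjoint[of "\<pi> 1" "\<psi> 2" "\<psi> 1"]
  by (simp add: T_commute)

text \<open>
  The operator \<open>a \<sharp> _\<close> is self-adjoint for \<open>T\<close>. The four equations compare the pairs \<open>(\<psi>\<^sub>1, \<psi>\<^sub>2)\<close>,
  \<open>(\<chi>\<^sub>1, \<psi>\<^sub>1)\<close>, \<open>(\<chi>\<^sub>1, \<psi>\<^sub>2)\<close> and \<open>(\<chi>\<^sub>2, \<psi>\<^sub>2)\<close>.
\<close>
lemma acts_by_equations:
  assumes "acts_by a r"
  shows "self_adjoint_eqs r (T (\<psi> 1) (\<psi> 1)) (T (\<psi> 1) (\<psi> 2)) (T (\<psi> 2) (\<psi> 2))
    (T (\<chi> 1) (\<psi> 1)) (T (\<chi> 1) (\<psi> 2)) (T (\<chi> 2) (\<psi> 2))"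
  unfolding self_adjoint_eqs_def
proof (intro conjI)
  note rules = acts_byD(3,4)[OF assms] acts_by_chi[OF assms] T_simps T_chi_psi_commute
    T_commute[of "\<psi> 2" "\<psi> 1"]
  show "r 4 * T (\<psi> 1) (\<psi> 1) - 2 * r 3 * T (\<psi> 1) (\<psi> 2) + r 2 * T (\<psi> 2) (\<psi> 2) = 0"
    using T_self_adjoint[of a "\<psi> 1" "\<psi> 2"] by (simp add: rules algebra_simps)
  show "r 1 * T (\<psi> 1) (\<psi> 1) + 2 * r 3 * T (\<chi> 1) (\<psi> 1) - 2 * r 2 * T (\<chi> 1) (\<psi> 2) = 0"
    using T_self_adjoint[of a "\<chi> 1" "\<psi> 1"] by (simp add: rules algebra_simps)
  show "r 1 * T (\<psi> 1) (\<psi> 2) + r 4 * T (\<chi> 1) (\<psi> 1) - r 2 * T (\<chi> 2) (\<psi> 2) = 0"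
    using T_self_adjoint[of a "\<chi> 1" "\<psi> 2"] by (simp add: rules algebra_simps)
  show "r 1 * T (\<psi> 2) (\<psi> 2) + 2 * r 4 * T (\<chi> 1) (\<psi> 2) - 2 * r 3 * T (\<chi> 2) (\<psi> 2) = 0"
    using T_self_adjoint[of a "\<chi> 2" "\<psi> 2"] by (simp add: rules algebra_simps)
qed

end

section \<open>Adjoint and norm in terms of Peirce components\<close>

context primitive_cubic
begin

lemma norm_zero: "N 0 = 0"
  using cubic_kernel_scale(1)[of 0] by (simp add: N_eq_cubic_kernel)

lemma norm_e: "N e = 0"
  using adjoint_identity[of e] e_nonzero by (simp add: sharp_e sharp_zero)

text \<open>
  \<open>N(a) a = (a\<^sup>\<sharp>)\<^sup>\<sharp>\<close> is zero because \<open>a\<^sup>\<sharp>\<close> is a multiple of \<open>e\<close> and \<open>e\<^sup>\<sharp> = 0\<close>.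
\<close>
lemma norm_peirce_zero:
  assumes "a \<in> peirce_zero e"
  shows "N a = 0"
proof -
  have "N a *s a = 0"
    using adjoint_identity[of a] by (simp add: sharp_peirce_zero assms sharp_scale sharp_e)
  then show ?thesis using norm_zero by auto
qed

text \<open>
  \<open>N(h) h = (h\<^sup>\<sharp>)\<^sup>\<sharp>\<close> lies both in \<open>J\<^bsub>1/2\<^esub>\<close> and in the multiples of \<open>e\<close>. Euler's identity
  \<open>3 N(h) = T(h, h\<^sup>\<sharp>) = 0\<close> would say nothing in characteristic 3.
\<close>
lemma norm_peirce_half:
  assumes "h \<in> peirce_half e"
  shows "N h = 0"
proof -
  have "N h *s h = S (sharp h) *s e"
    using adjoint_identity[of h] sharp_peirce_zero[OF sharp_peirce_half[OF assms]] by simp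
  moreover from this have "N h * T e h = S (sharp h) * T e e"
    by (metis T_scale(2))
  then have "S (sharp h) = 0"
    using assms by (simp add: T_e_e peirce_half_iff)
  ultimately show ?thesis using norm_zero by auto
qed

lemma sharp_peirce:
  assumes "a \<in> peirce_zero e" "h \<in> peirce_half e"
  shows "sharp (u *s e + a + h) = S a *s e + (sharp h + u *s (e \<sharp> a)) + a \<sharp> h"
proof -
  have "e \<sharp> h = 0" using assms by (simp add: peirce_half_iff)
  then show ?thesis
    by (simp add: sharp_add sharp_scale sharp_e cross_simps sharp_peirce_zero assms
        cross_commute[of a e] cross_commute[of h e] algebra_simps)
qed

lemma norm_peirce:
  assumes a: "a \<in> peirce_zero e" and h: "h \<in> peirce_half e"
  shows "N (u *s e + a + h) = u * S a + T a (sharp h)"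
proof -
  have ah: "N (a + h) = T a (sharp h)"
    by (simp add: norm_add norm_peirce_zero norm_peirce_half sharp_peirce_zero a h T_scale)
      (use h in \<open>simp add: peirce_half_iff\<close>)
  have "sharp (a + h) = S a *s e + sharp h + a \<sharp> h"
    using sharp_peirce[OF a h, of 0] by simp
  moreover have "T e (sharp h) = 0"
    using sharp_peirce_half[OF h] by (simp add: peirce_zero_iff)
  moreover have "T e (a \<sharp> h) = 0"
    using T_zero_half[OF cross_e_involution(2)[OF a] h] by (simp add: T_cross_assoc)
  ultimately have "T e (sharp (a + h)) = S a" by (simp add: T_simps T_e_e)
  moreover have "N (u *s e) = 0"
    using norm_e by (simp add: N_eq_cubic_kernel cubic_kernel_scale)
  ultimately have "N (u *s e + (a + h)) = u * S a + T a (sharp h)"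
    by (simp add: norm_add[of "u *s e"] ah sharp_scale sharp_e T_simps)
  then show ?thesis by (simp add: add.assoc)
qed

end

section \<open>The trace form on the half space up to a scalar\<close>

text \<open>
  Proportional vectors span the same space, and by counting a spanning family with the right number
  of members is a basis.
\<close>
lemma (in vector_space) basis_of_scaled:
  assumes basis: "basis_of scale bs W" and len: "length cs = length bs" and nz: "0 \<notin> set cs"
  shows "basis_of scale (map2 scale cs bs) W"
proof -
  define c where "c v = the (map_of (zip bs cs) v)" for v
  have W: "W = span (set bs)" and ind: "independent (set bs)" and dist: "distinct bs"
    using basis by (auto simp: basis_of_def)
  have c_nth: "c (bs ! i) = cs ! i" if "i < length bs" for i
    using that len dist by (simp add: c_def map_of_zip_nth)
  have map2: "map2 scale cs bs = map (\<lambda>v. scale (c v) v) bs"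
    using len c_nth by (intro nth_equalityI) auto
  have c_nz: "c v \<noteq> 0" if v: "v \<in> set bs" for v
  proof -
    obtain i where "i < length bs" "bs ! i = v" using v by (auto simp: in_set_conv_nth)
    then show ?thesis using c_nth nz len nth_mem[of i cs] by metis
  qed
  define S' where "S' = (\<lambda>v. scale (c v) v) ` set bs"
  have span: "span S' = W"
    unfolding S'_def W using c_nz by (intro span_image_scale) auto
  obtain B where B: "B \<subseteq> S'" "independent B" "S' \<subseteq> span B" "card B = dim S'"
    using basis_exists by blast
  have "card B = length bs"
    using B(4) dim_span[of S'] ind dist
    by (simp add: span W dim_eq_card_independent distinct_card)
  moreover have "card S' \<le> length bs"
    unfolding S'_def using card_image_le[of "set bs"] dist by (simp add: distinct_card)
  moreover have fin: "finite S'" by (simp add: S'_def)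
  ultimately have card: "card S' = length bs" and card_B: "card B = card S'"
    using B(1) card_mono[OF fin B(1)] by auto
  have "B = S'" by (rule card_subset_eq[OF fin B(1) card_B])
  then have "independent S'" using B(2) by simp
  moreover have "distinct (map (\<lambda>v. scale (c v) v) bs)"
    using card by (intro card_distinct) (simp add: S'_def)
  ultimately show ?thesis
    using span unfolding map2 by (simp add: basis_of_def S'_def)
qed

context nondegenerate_frame
begin

text \<open>
  Such an \<open>a\<close> annihilates \<open>V\<close>, so by the Clifford relation it is orthogonal to all \<open>\<pi>\<^sub>i\<close>, and the trace
  form is nondegenerate.
\<close>
lemma acts_by_zero:
  assumes r: "acts_by a r" and zero: "r 1 = 0" "r 2 = 0" "r 3 = 0" "r 4 = 0"
  shows "a = 0"
proof -
  note a = acts_byD[OF r]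
  have psi: "a \<sharp> \<psi> 1 = 0" "a \<sharp> \<psi> 2 = 0" using a zero by simp_all
  have S2: "S2 a b = 0" if b: "acts_by b r'" for b r'
  proof -
    have "a \<sharp> (b \<sharp> \<psi> 1) + b \<sharp> (a \<sharp> \<psi> 1) = - (S2 a b *s \<psi> 1)"
      by (rule clifford_relation_polarized[OF a(1) acts_byD(1)[OF b] psi_half(1)])
    then have "S2 a b *s \<psi> 1 + 0 *s \<psi> 2 = 0"
      by (simp add: acts_byD[OF b] psi cross_simps)
    then show ?thesis using psi_independent by blast
  qed
  have T_S2: "T a b = - S2 a b" for b
    using trace_cross[of a b] traceless_zeroD[OF a(1)] by (simp add: S_cross)
  have S2_1: "S2 a (\<pi> 1) = 0"
    using a(2) zero by (simp add: S_cross cross_commute[of a])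
  have S2_4: "S2 a (\<pi> 4) = 0"
    using S2[OF acts_by_pi(2)] by (simp add: S_cross cross_simps trace_simps)
  show ?thesis
  proof (rule eq_if_T_eq_basis)
    show "T a \<upsilon> = T 0 \<upsilon>"
      using traceless_zeroD[OF a(1)] by (simp add: T_zero T_commute[of a])
    show "T a (\<pi> i) = T 0 (\<pi> i)" if "i \<in> {1, 2, 3, 4}" for i
      using that traceless_zeroD(6)[OF a(1)] S2[OF acts_by_pi(1)] S2_1 S2_4
        T_S2[of "\<pi> 1"] T_S2[of "\<pi> 2"] T_S2[of "\<pi> 4"]
      by (auto simp: T_zero pi3 T_commute[of a f])
  qed (use a(1) psi_half chi_half in \<open>auto simp: traceless_zero_def T_zero_half T_zero\<close>)
qed

lemma action_nondegenerate:
  "ST s t 1 2 \<noteq> 0 \<or> ST s t 2 3 \<noteq> 0 \<or> ST s t 2 4 \<noteq> 0 \<or> ST s t 3 4 \<noteq> 0"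
proof (rule ccontr)
  assume ST: "\<not> ?thesis"
  \<comment> \<open>If all these minors vanish then \<open>s\<close> and \<open>t\<close> are proportional, and this combination has zero parameters.\<close>
  let ?n = "t 2 *s \<pi> 2 + (- s 2) *s (- \<pi> 4)"
  have "?n = 0"
    using ST by (intro acts_by_zero[OF acts_by_combination[OF acts_by_pi]])
      (auto simp: ST_def mult.commute)
  then have "t 2 *s \<pi> 2 + s 2 *s \<pi> 4 = 0" by simp
  then show False using pi24_independent nonzero by blast
qed

text \<open>
  The scalar is nonzero because otherwise \<open>\<psi>\<^sub>1\<close> would be in the radical of the trace form.
\<close>
lemma T_half_proportional:
  "\<exists>k. k \<noteq> 0 \<and> T (\<psi> 1) (\<psi> 1) = 2 * k * ST s t 2 3 \<and> T (\<psi> 1) (\<psi> 2) = k * ST s t 2 4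
    \<and> T (\<psi> 2) (\<psi> 2) = 2 * k * ST s t 3 4 \<and> T (\<chi> 1) (\<psi> 1) = k * ST s t 1 2
    \<and> T (\<chi> 1) (\<psi> 2) = k * ST s t 1 3 \<and> T (\<chi> 2) (\<psi> 2) = k * ST s t 1 4"
proof -
  from self_adjoint_unique[OF two_nonzero nonzero(1-3) action_nondegenerate
      acts_by_equations[OF acts_by_pi(1)] acts_by_equations[OF acts_by_pi(2)]]
  obtain k where k: "T (\<psi> 1) (\<psi> 1) = 2 * k * ST s t 2 3 \<and> T (\<psi> 1) (\<psi> 2) = k * ST s t 2 4
    \<and> T (\<psi> 2) (\<psi> 2) = 2 * k * ST s t 3 4 \<and> T (\<chi> 1) (\<psi> 1) = k * ST s t 1 2
    \<and> T (\<chi> 1) (\<psi> 2) = k * ST s t 1 3 \<and> T (\<chi> 2) (\<psi> 2) = k * ST s t 1 4" ..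
  have "k \<noteq> 0"
  proof
    assume "k = 0"
    with k have zero: "T (\<psi> 1) (\<psi> 1) = 0" "T (\<psi> 1) (\<psi> 2) = 0"
      "T (\<psi> 1) (\<chi> 1) = 0" "T (\<psi> 1) (\<chi> 2) = 0"
      by (simp_all add: T_chi_psi_commute T_commute[of "\<psi> 1" "\<chi> 1"]
          T_commute[of "\<psi> 1" "\<chi> 2"])
    have pi: "\<pi> i \<in> peirce_zero \<upsilon>" if "i \<in> {1, 2, 3, 4}" for i
      using that pi_traceless f_in_peirce_zero by (auto simp: traceless_zero_def pi3)
    have "\<psi> 1 = 0"
    proof (rule eq_if_T_eq_basis)
      show "T (\<psi> 1) \<upsilon> = T 0 \<upsilon>"
        using psi_half(1) T_commute[of "\<psi> 1" \<upsilon>] by (simp add: T_zero peirce_half_iff)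
      show "T (\<psi> 1) (\<pi> i) = T 0 (\<pi> i)" if "i \<in> {1, 2, 3, 4}" for i
        using T_zero_half[OF pi[OF that] psi_half(1)] T_commute[of "\<psi> 1" "\<pi> i"]
        by (simp add: T_zero)
    qed (use zero in \<open>auto simp: T_zero\<close>)
    then have "1 *s \<psi> 1 + 0 *s \<psi> 2 = 0" by simp
    from psi_independent[OF this] show False by simp
  qed
  with k show ?thesis by (intro exI[of _ k]) simp
qed

text \<open>
  Scaling \<open>\<psi>\<^sub>1\<close> and \<open>\<psi>\<^sub>2\<close> by the same factor does not change the matrices of \<open>\<pi>\<^sub>2\<close> and \<open>\<pi>\<^sub>4\<close> on \<open>V\<close>.
\<close>
lemma scaled_frame:
  assumes c: "c \<noteq> 0"
  shows "peirce_frame scale N sharp one \<upsilon> \<pi> V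
    (\<psi>(1 := c *s \<psi> 1, 2 := c *s \<psi> 2)) (\<chi>(1 := c *s \<chi> 1, 2 := c *s \<chi> 2)) z s t"
proof -
  have psi': "basis_of scale [c *s \<psi> 1, c *s \<psi> 2] V"
    using basis_of_scaled[OF psi_basis, of "[c, c]"] c by simp
  let ?cs = "[1, 1, 1, 1, 1, c, c, c, c]"
    and ?bs = "[\<upsilon>, \<pi> 1, \<pi> 2, \<pi> 3, \<pi> 4, \<psi> 1, \<psi> 2, \<chi> 1, \<chi> 2]"
    and ?bs' = "[\<upsilon>, \<pi> 1, \<pi> 2, \<pi> 3, \<pi> 4, c *s \<psi> 1, c *s \<psi> 2, c *s \<chi> 1, c *s \<chi> 2]"
  have "length ?cs = length ?bs" by simp
  moreover have "0 \<notin> set ?cs" using c by simp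
  ultimately have "basis_of scale (map2 scale ?cs ?bs) UNIV"
    by (rule basis_of_scaled[OF basis])
  moreover have "map2 scale ?cs ?bs = ?bs'" by simp
  ultimately have basis': "basis_of scale ?bs' UNIV" by (simp only:)
  show ?thesis
    by (intro peirce_frame.intro peirce_frame_axioms.intro cubic_jordan_algebra_axioms)
      (rule primitive pi3 pi_basis S_pi2 S_pi4 V_half pi2_V pi4_V dim_pi1_V half_sum
        half_direct z s1 t1 nonzero
       | (simp add: psi' basis'; fail)
       | simp add: chi1 chi2 cross_simps pi2_psi1 pi2_psi2 pi4_psi1 pi4_psi2
         scale_right_distrib scale_right_diff_distrib mult.commute)+
qed

section \<open>Coordinates in a frame\<close>

lemma zero_part_add: "zero_part a1 a2 a3 a4 + zero_part b1 b2 b3 b4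
    = zero_part (a1 + b1) (a2 + b2) (a3 + b3) (a4 + b4)"
  by (simp add: zero_part_def scale_left_distrib)

lemma half_part_add: "half_part a1 a2 a3 a4 + half_part b1 b2 b3 b4
    = half_part (a1 + b1) (a2 + b2) (a3 + b3) (a4 + b4)"
  by (simp add: half_part_def scale_left_distrib)

lemma half_part_scale: "c *s half_part a1 a2 a3 a4 = half_part (c * a1) (c * a2) (c * a3) (c * a4)"
  by (simp add: half_part_def scale_right_distrib)

lemma zero_part_scale: "c *s zero_part a1 a2 a3 a4 = zero_part (c * a1) (c * a2) (c * a3) (c * a4)"
  by (simp add: zero_part_def scale_right_distrib)

lemma pi1_cross_half_part:
  "\<pi> 1 \<sharp> half_part x1 x2 y1 y2 = half_part (- y1) (- y2) (- z * x1) (- z * x2)"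
  by (simp add: half_part_def cross_simps pi1_psi pi1_chi mult.commute)

lemma pi3_cross_half_part:
  "\<pi> 3 \<sharp> half_part x1 x2 y1 y2 = half_part (- x1) (- x2) (- y1) (- y2)"
  using f_cross_half[OF half_part_mem, of x1 x2 y1 y2]
  by (simp add: pi3 half_part_def)

lemma acts_by_cross_half_part:
  assumes "acts_by a r"
  shows "a \<sharp> half_part x1 x2 y1 y2 = half_part (r 3 * x1 + r 4 * x2) (- r 2 * x1 - r 3 * x2)
     (r 1 * x1 - r 3 * y1 - r 4 * y2) (r 1 * x2 + r 2 * y1 + r 3 * y2)"
  by (simp add: half_part_def cross_simps acts_byD[OF assms] acts_by_chi[OF assms])
     (simp add: algebra_simps)

lemma zero_part_eq:
  "zero_part p1 p2 p3 p4 = p1 *s \<pi> 1 + p3 *s \<pi> 3 + (p2 *s \<pi> 2 + (- p4) *s (- \<pi> 4))"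
  by (simp add: zero_part_def algebra_simps)

lemma zero_part_cross_half_part:
  "zero_part (p 1) (p 2) (p 3) (p 4) \<sharp> half_part (x 1) (x 2) (y 1) (y 2)
    = half_part (x1_sharp z s t u p x y) (x2_sharp z s t u p x y)
        (y1_sharp z s t u p x y) (y2_sharp z s t u p x y)"
proof -
  obtain a where a: "acts_by a (\<lambda>i. p 2 * s i + (- p 4) * t i)"
    and eq: "zero_part (p 1) (p 2) (p 3) (p 4) = p 1 *s \<pi> 1 + p 3 *s \<pi> 3 + a"
    using acts_by_combination[OF acts_by_pi] zero_part_eq by blast
  show ?thesis
    unfolding eq cross_add(1) cross_scale(1) acts_by_cross_half_part[OF a]
      pi1_cross_half_part pi3_cross_half_part half_part_scale half_part_add
    by (rule arg_cong4[where f = half_part])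
      (simp_all add: x1_sharp_def x2_sharp_def y1_sharp_def y2_sharp_def algebra_simps)
qed

lemma S_pi3: "S (\<pi> 3) = 1"
  by (simp add: S_def pi3 sharp_f trace_e)

lemma S_zero_part:
  "S (zero_part (p 1) (p 2) (p 3) (p 4)) = u_sharp z s t u p x y"
proof -
  obtain a where a: "acts_by a (\<lambda>i. p 2 * s i + (- p 4) * t i)"
    and eq: "zero_part (p 1) (p 2) (p 3) (p 4) = p 1 *s \<pi> 1 + p 3 *s \<pi> 3 + a"
    using acts_by_combination[OF acts_by_pi] zero_part_eq by blast
  have "\<pi> 3 \<sharp> a = 0" "\<pi> 1 \<sharp> \<pi> 3 = 0"
    using traceless_zeroD(5)[OF acts_byD(1)[OF a]] traceless_zeroD(5)[OF pi_traceless(1)]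
    by (simp_all add: pi3 cross_commute[of "\<pi> 1"])
  then have "S (zero_part (p 1) (p 2) (p 3) (p 4))
      = (p 1)\<^sup>2 * S (\<pi> 1) + (p 3)\<^sup>2 + S a + p 1 * S2 (\<pi> 1) a"
    unfolding eq by (simp add: S_add S_scale S_cross S_pi3 cross_simps trace_simps trace_zero)
  then show ?thesis
    using z by (simp add: acts_by_S[OF a] acts_byD(2)[OF a] u_sharp_def algebra_simps)
qed

lemma gram_traceless:
  assumes "a \<in> traceless_zero"
  shows "T a b = - S2 a b"
  using trace_cross[of a b] traceless_zeroD[OF assms] by (simp add: S_cross)

text \<open>
  On trace zero elements of \<open>J\<^sub>0\<close> the trace form is \<open>- S(\<cdot>, \<cdot>)\<close>, and \<open>S\<close> is known on the combinations of
  \<open>\<pi>\<^sub>2\<close> and \<open>\<pi>\<^sub>4\<close> as minus the square of their action on \<open>V\<close>.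
\<close>
lemma gram_zero:
  "T (\<pi> 1) (\<pi> 1) = 2 * z" "T (\<pi> 1) (\<pi> 2) = - s 1" "T (\<pi> 1) (\<pi> 4) = t 1"
  "T (\<pi> 2) (\<pi> 2) = 2 * ((s 3)\<^sup>2 - s 2 * s 4)" "T (\<pi> 4) (\<pi> 4) = 2 * ((t 3)\<^sup>2 - t 2 * t 4)"
  "T (\<pi> 2) (\<pi> 4) = s 4 * t 2 - 2 * s 3 * t 3 + s 2 * t 4" "T (\<pi> 3) (\<pi> 3) = 2"
  "T (\<pi> 3) (\<pi> 1) = 0" "T (\<pi> 3) (\<pi> 2) = 0" "T (\<pi> 3) (\<pi> 4) = 0"
proof -
  have S2_self: "S2 a a = 2 * S a" for a
    by (simp add: S_cross cross_self trace_simps S_def)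
  have S2_4: "S2 (\<pi> 2) (- \<pi> 4) = - S2 (\<pi> 2) (\<pi> 4)" and S4: "S (- \<pi> 4) = S (\<pi> 4)"
    using S_scale[of "-1" "\<pi> 4"] by (simp_all add: S_cross cross_simps trace_simps)
  have "S (\<pi> 2 + (- \<pi> 4)) = (s 2 + t 2) * (s 4 + t 4) - (s 3 + t 3)\<^sup>2"
    using acts_by_S[OF acts_by_combination[OF acts_by_pi, of 1 1]] by (simp only: mult_1 scale_one)
  then have "S2 (\<pi> 2) (\<pi> 4) = 2 * s 3 * t 3 - s 4 * t 2 - s 2 * t 4"
    using acts_by_S[OF acts_by_pi(1)] acts_by_S[OF acts_by_pi(2)] S2_4
    by (simp only: S_add S4 S2_4) (simp add: algebra_simps power2_eq_square)
  then show "T (\<pi> 2) (\<pi> 4) = s 4 * t 2 - 2 * s 3 * t 3 + s 2 * t 4"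
    by (simp add: gram_traceless pi_traceless)
  show "T (\<pi> 1) (\<pi> 1) = 2 * z" "T (\<pi> 1) (\<pi> 2) = - s 1" "T (\<pi> 1) (\<pi> 4) = t 1"
    "T (\<pi> 2) (\<pi> 2) = 2 * ((s 3)\<^sup>2 - s 2 * s 4)" "T (\<pi> 4) (\<pi> 4) = 2 * ((t 3)\<^sup>2 - t 2 * t 4)"
    using acts_by_S[OF acts_by_pi(2)]
    by (simp_all add: gram_traceless pi_traceless S2_self S4 acts_by_S[OF acts_by_pi(1)] s1 t1 z)
  show "T (\<pi> 3) (\<pi> 3) = 2"
    by (simp add: pi3 T_simps T_one trace_simps trace_one trace_e T_e_e)
  show "T (\<pi> 3) (\<pi> 1) = 0" "T (\<pi> 3) (\<pi> 2) = 0" "T (\<pi> 3) (\<pi> 4) = 0"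
    using pi_traceless[THEN traceless_zeroD(6)] by (simp_all add: pi3)
qed

lemma T_zero_part:
  "T (zero_part (p 1) (p 2) (p 3) (p 4)) (zero_part q1 q2 q3 q4) = trace_zero z s t p q1 q2 q3 q4"
proof -
  have sym: "T (\<pi> 2) (\<pi> 1) = - s 1" "T (\<pi> 4) (\<pi> 1) = t 1"
    "T (\<pi> 4) (\<pi> 2) = s 4 * t 2 - 2 * s 3 * t 3 + s 2 * t 4"
    "T (\<pi> 1) (\<pi> 3) = 0" "T (\<pi> 2) (\<pi> 3) = 0" "T (\<pi> 4) (\<pi> 3) = 0"
    using gram_zero by (simp_all add: T_commute)
  show ?thesis
    by (simp add: zero_part_def trace_zero_def T_simps gram_zero sym) (simp add: algebra_simps)
qed

lemma upsilon_cross_zero_part: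
  "\<upsilon> \<sharp> zero_part a1 a2 a3 a4 = zero_part (- a1) (- a2) a3 (- a4)"
proof -
  have "\<upsilon> \<sharp> \<pi> 3 = \<pi> 3" unfolding pi3 by (rule cross_e_f)
  then show ?thesis
    using pi_traceless[THEN traceless_zeroD(4)] by (simp add: zero_part_def cross_simps)
qed

end

section \<open>Normalised frames\<close>

text \<open>
  A frame in which the trace form on \<open>J\<^bsub>1/2\<^esub>\<close> is the solution of the self-adjointness equations with
  proportionality factor 2.
\<close>
locale normalized_frame = nondegenerate_frame +
  assumes T_psi: "T (\<psi> 1) (\<psi> 1) = 4 * ST s t 2 3" "T (\<psi> 1) (\<psi> 2) = 2 * ST s t 2 4"
      "T (\<psi> 2) (\<psi> 2) = 4 * ST s t 3 4"
    and T_chi_psi: "T (\<chi> 1) (\<psi> 1) = 2 * ST s t 1 2" "T (\<chi> 1) (\<psi> 2) = 2 * ST s t 1 3"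
      "T (\<chi> 2) (\<psi> 2) = 2 * ST s t 1 4"
begin

text \<open>
  The values at two of the \<open>\<chi>\<^sub>i\<close> follow from those at the \<open>\<psi>\<^sub>i\<close>: moving \<open>\<pi>\<^sub>1\<close> to the other side gives
  \<open>T(\<chi>\<^sub>i, \<chi>\<^sub>j) = - S(\<pi>\<^sub>1) T(\<psi>\<^sub>i, \<psi>\<^sub>j)\<close>.
\<close>
lemma T_half_part:
  "T (half_part (x 1) (x 2) (y 1) (y 2)) (half_part a1 a2 b1 b2)
    = 2 * half_trace_half z s t x y a1 a2 b1 b2"
proof -
  have chi: "T (\<chi> i) (\<chi> j) = z * T (\<psi> i) (\<psi> j)" if "i \<in> {1,2}" "j \<in> {1,2}" for i j
  proof -
    have "T (\<chi> i) (\<chi> j) = - T (\<psi> i) (\<pi> 1 \<sharp> \<chi> j)"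
    proof -
      have "\<chi> i = - (\<pi> 1 \<sharp> \<psi> i)" using that pi1_psi by auto
      then show ?thesis by (simp add: T_minus T_self_adjoint)
    qed
    then show ?thesis using that by (auto simp: pi1_chi T_simps)
  qed
  have sym: "T (\<psi> 2) (\<psi> 1) = T (\<psi> 1) (\<psi> 2)" "T (\<psi> 1) (\<chi> 1) = T (\<chi> 1) (\<psi> 1)"
    "T (\<psi> 1) (\<chi> 2) = T (\<chi> 1) (\<psi> 2)" "T (\<psi> 2) (\<chi> 1) = T (\<chi> 1) (\<psi> 2)"
    "T (\<psi> 2) (\<chi> 2) = T (\<chi> 2) (\<psi> 2)"
    using T_chi_psi_commute by (simp_all add: T_commute)
  show ?thesis
    by (simp add: half_part_def half_trace_half_def T_simps chi sym T_chi_psi_commute T_psi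
        T_chi_psi) (simp add: algebra_simps)
qed

text \<open>
  Both sides lie in \<open>J\<^sub>0\<close>, and both have the same pairing with every element \<open>a\<close> of \<open>J\<^sub>0\<close>, because
  \<open>2 T(h\<^sup>\<sharp>, a) = T(h, a \<sharp> h)\<close>.
\<close>
lemma sharp_half_part:
  "sharp (half_part (x 1) (x 2) (y 1) (y 2))
    = zero_part (p1_sharp z s t 0 p x y) (p2_sharp z s t 0 p x y)
        (p3_sharp z s t 0 p x y) (p4_sharp z s t 0 p x y)" (is "sharp ?h = ?q p")
proof -
  have q: "?q p = ?q p'" for p'
    by (simp add: p1_sharp_def p2_sharp_def p3_sharp_def p4_sharp_def)
  have *: "T (sharp ?h) (zero_part (p' 1) (p' 2) (p' 3) (p' 4))
      = T (?q p) (zero_part (p' 1) (p' 2) (p' 3) (p' 4))" for p' :: "nat \<Rightarrow> 'a"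
  proof -
    let ?a = "zero_part (p' 1) (p' 2) (p' 3) (p' 4)"
    have "2 * T (sharp ?h) ?a = T (?h \<sharp> ?h) ?a" by (simp add: cross_self T_scale)
    also have "\<dots> = T ?h (?a \<sharp> ?h)" by (simp add: T_cross_assoc cross_commute)
    also have "\<dots> = 2 * trace_zero z s t p' (p1_sharp z s t 0 p' x y) (p2_sharp z s t 0 p' x y)
        (p3_sharp z s t 0 p' x y) (p4_sharp z s t 0 p' x y)"
      unfolding zero_part_cross_half_part[of p' x y 0] T_half_part half_trace_half_sharp ..
    also have "\<dots> = 2 * T (?q p') ?a"
      unfolding T_zero_part[symmetric] by (simp add: T_commute)
    finally show ?thesis using two_nonzero q[of p'] by simp
  qed
  show ?thesis
  proof (rule eq_if_T_eq_basis)
    have zero: "sharp ?h \<in> peirce_zero \<upsilon>" "?q p \<in> peirce_zero \<upsilon>"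
      by (rule sharp_peirce_half half_part_mem zero_part_mem)+
    then show "T (sharp ?h) \<upsilon> = T (?q p) \<upsilon>"
      by (simp add: peirce_zero_iff T_commute[of _ \<upsilon>])
    show "T (sharp ?h) (\<pi> i) = T (?q p) (\<pi> i)" if i: "i \<in> {1, 2, 3, 4}" for i
    proof -
      have "\<pi> i = zero_part (of_bool (i = 1)) (of_bool (i = 2)) (of_bool (i = 3)) (of_bool (i = 4))"
        using i by (auto simp: zero_part_def)
      then show ?thesis using *[of "\<lambda>j. of_bool (i = j)"] by simp
    qed
    show "T (sharp ?h) (\<psi> i) = T (?q p) (\<psi> i)" if "i \<in> {1, 2}" for i
      using that psi_half by (auto simp: T_zero_half zero)
    show "T (sharp ?h) (\<chi> i) = T (?q p) (\<chi> i)" if "i \<in> {1, 2}" for i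
      using that chi_half by (auto simp: T_zero_half zero)
  qed
qed

lemma sharp_half_plus:
  "sharp (half_part (x 1) (x 2) (y 1) (y 2)) + u *s (\<upsilon> \<sharp> zero_part (p 1) (p 2) (p 3) (p 4))
    = zero_part (p1_sharp z s t u p x y) (p2_sharp z s t u p x y)
        (p3_sharp z s t u p x y) (p4_sharp z s t u p x y)"
  unfolding sharp_half_part[of x y p] upsilon_cross_zero_part zero_part_scale zero_part_add
  by (rule arg_cong4[where f = zero_part])
    (simp_all add: p1_sharp_def p2_sharp_def p3_sharp_def p4_sharp_def)

lemma norm_parts:
  "N (u *s \<upsilon> + zero_part (p 1) (p 2) (p 3) (p 4) + half_part (x 1) (x 2) (y 1) (y 2))
    = norm_formula z s t u p x y"
  unfolding norm_peirce[OF zero_part_mem half_part_mem] S_zero_part[of p u x y]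
    sharp_half_part[of x y p] T_zero_part norm_formula_def ..

end

theorem corollary2p11:
  fixes scale :: "'k::alg_closed_field \<Rightarrow> 'v::ab_group_add \<Rightarrow> 'v" (infixr "*s" 75)
    and N :: "'v \<Rightarrow> 'k" and sharp :: "'v \<Rightarrow> 'v" and one :: 'v
    and \<upsilon> :: 'v and \<pi> :: "nat \<Rightarrow> 'v" and V :: "'v set" and \<psi> \<chi> :: "nat \<Rightarrow> 'v"
    and z :: 'k and s t :: "nat \<Rightarrow> 'k"
  assumes J: "cubic_jordan_algebra scale N sharp one"
    and dim: "vector_space.dim scale (UNIV :: 'v set) = 9"
    and nondegenerate: "jordan_data.nondegenerate scale N sharp one"
    and simple: "jordan_data.simple scale N sharp one"
    and trace_nondegenerate: "jordan_data.trace_nondegenerate scale N one"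
    and idempotents: "jordan_data.one_sum_of_three_primitives scale N sharp one"
    and frame: "peirce_frame scale N sharp one \<upsilon> \<pi> V \<psi> \<chi> z s t"
  shows "\<exists>c1 c2. c1 \<noteq> 0 \<and> c2 \<noteq> 0 \<and>
    (let \<psi>' = \<psi>(1 := c1 *s \<psi> 1, 2 := c2 *s \<psi> 2);
         \<chi>' = \<chi>(1 := c1 *s \<chi> 1, 2 := c2 *s \<chi> 2);
         s' = s(2 := c1 / c2 * s 2, 4 := c2 / c1 * s 4);
         t' = t(2 := c1 / c2 * t 2, 4 := c2 / c1 * t 4)
     in
      peirce_frame scale N sharp one \<upsilon> \<pi> V \<psi>' \<chi>' z s' t' \<and>
      (\<forall>u p x y \<sigma>0 \<sigma>h \<sigma>.
        \<sigma>0 = p 1 *s \<pi> 1 + p 2 *s \<pi> 2 + p 3 *s \<pi> 3 + p 4 *s \<pi> 4 \<longrightarrow>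
        \<sigma>h = x 1 *s \<chi>' 1 + x 2 *s \<chi>' 2 + y 1 *s \<psi>' 1 + y 2 *s \<psi>' 2 \<longrightarrow>
        \<sigma> = u *s \<upsilon> + \<sigma>0 + \<sigma>h \<longrightarrow>
          \<sigma>0 \<in> jordan_data.peirce_zero scale N sharp one \<upsilon> \<and>
          \<sigma>h \<in> jordan_data.peirce_half scale N sharp one \<upsilon> \<and>
          jordan_data.S scale N sharp one \<sigma>0 = u_sharp z s' t' u p x y \<and>
          sharp \<sigma>h + u *s jordan_data.cross sharp \<upsilon> \<sigma>0
            \<in> jordan_data.peirce_zero scale N sharp one \<upsilon> \<and>
          sharp \<sigma>h + u *s jordan_data.cross sharp \<upsilon> \<sigma>0
            = p1_sharp z s' t' u p x y *s \<pi> 1 + p2_sharp z s' t' u p x y *s \<pi> 2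
            + p3_sharp z s' t' u p x y *s \<pi> 3 + p4_sharp z s' t' u p x y *s \<pi> 4 \<and>
          jordan_data.cross sharp \<sigma>0 \<sigma>h \<in> jordan_data.peirce_half scale N sharp one \<upsilon> \<and>
          jordan_data.cross sharp \<sigma>0 \<sigma>h
            = x1_sharp z s' t' u p x y *s \<chi>' 1 + x2_sharp z s' t' u p x y *s \<chi>' 2
            + y1_sharp z s' t' u p x y *s \<psi>' 1 + y2_sharp z s' t' u p x y *s \<psi>' 2 \<and>
          sharp \<sigma> = u_sharp z s' t' u p x y *s \<upsilon>
            + p1_sharp z s' t' u p x y *s \<pi> 1 + p2_sharp z s' t' u p x y *s \<pi> 2
            + p3_sharp z s' t' u p x y *s \<pi> 3 + p4_sharp z s' t' u p x y *s \<pi> 4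
            + x1_sharp z s' t' u p x y *s \<chi>' 1 + x2_sharp z s' t' u p x y *s \<chi>' 2
            + y1_sharp z s' t' u p x y *s \<psi>' 1 + y2_sharp z s' t' u p x y *s \<psi>' 2) \<and>
      (\<exists>P :: (upsilon_var \<Rightarrow>\<^sub>0 nat) \<Rightarrow>\<^sub>0 int.
        (\<forall>z s t u p x y.
           (N_Upsilon z s t u p x y :: rat) = eval_int_poly P (assignment z s t u p x y)) \<and>
        (\<forall>u p x y.
           let \<nu> = N (u *s \<upsilon> + p 1 *s \<pi> 1 + p 2 *s \<pi> 2 + p 3 *s \<pi> 3 + p 4 *s \<pi> 4
                      + x 1 *s \<chi>' 1 + x 2 *s \<chi>' 2 + y 1 *s \<psi>' 1 + y 2 *s \<psi>' 2)
           in \<nu> = eval_int_poly P (assignment z s' t' u p x y) \<and>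
              ((3::'k) \<noteq> 0 \<longrightarrow> \<nu> = N_Upsilon z s' t' u p x y))))"
proof -
  interpret frame: nondegenerate_frame scale N sharp one \<upsilon> \<pi> V \<psi> \<chi> z s t
    using frame trace_nondegenerate
    by (intro nondegenerate_frame.intro nondegenerate_frame_axioms.intro)
  obtain k where "k \<noteq> 0"
    and k: "frame.T (\<psi> 1) (\<psi> 1) = 2 * k * ST s t 2 3" "frame.T (\<psi> 1) (\<psi> 2) = k * ST s t 2 4"
      "frame.T (\<psi> 2) (\<psi> 2) = 2 * k * ST s t 3 4" "frame.T (\<chi> 1) (\<psi> 1) = k * ST s t 1 2"
      "frame.T (\<chi> 1) (\<psi> 2) = k * ST s t 1 3" "frame.T (\<chi> 2) (\<psi> 2) = k * ST s t 1 4"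
    using frame.T_half_proportional by blast
  \<comment> \<open>The scalar \<open>c\<^sup>2\<close> multiplies the form; it has to turn the factor \<open>k\<close> into 2.\<close>
  obtain c where c2: "c\<^sup>2 = 2 / k"
    using nth_root_exists[of 2 "2 / k"] by auto
  have c: "c \<noteq> 0"
    using c2 \<open>k \<noteq> 0\<close> frame.two_nonzero by auto
  have cck: "c * c * k = 2"
    using c2 \<open>k \<noteq> 0\<close> by (simp add: power2_eq_square)
  have ck: "c * (c * (k * r)) = 2 * r" "c * (c * (2 * k * r)) = 4 * r" for r
  proof -
    have "c * (c * (k * r)) = c * c * k * r" by (simp only: mult.assoc)
    then show "c * (c * (k * r)) = 2 * r" by (simp only: cck)
    have "c * (c * (2 * k * r)) = 2 * (c * c * k) * r" by (simp only: ac_simps)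
    then show "c * (c * (2 * k * r)) = 4 * r" by (simp add: cck)
  qed
  define \<psi>' where "\<psi>' = \<psi>(1 := c *s \<psi> 1, 2 := c *s \<psi> 2)"
  define \<chi>' where "\<chi>' = \<chi>(1 := c *s \<chi> 1, 2 := c *s \<chi> 2)"
  have frame': "peirce_frame scale N sharp one \<upsilon> \<pi> V \<psi>' \<chi>' z s t"
    unfolding \<psi>'_def \<chi>'_def by (rule frame.scaled_frame[OF c])
  interpret scaled: normalized_frame scale N sharp one \<upsilon> \<pi> V \<psi>' \<chi>' z s t
    using frame' trace_nondegenerate
    by (intro normalized_frame.intro nondegenerate_frame.intro nondegenerate_frame_axioms.intro
        normalized_frame_axioms.intro)
      (simp_all add: \<psi>'_def \<chi>'_def frame.T_scale k ck)
  have params: "s(2 := c / c * s 2, 4 := c / c * s 4) = s" "t(2 := c / c * t 2, 4 := c / c * t 4) = t"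
    using c by auto
  have adjoint: "\<sigma>0 \<in> frame.peirce_zero \<upsilon> \<and> \<sigma>h \<in> frame.peirce_half \<upsilon> \<and>
      frame.S \<sigma>0 = u_sharp z s t u p x y \<and>
      sharp \<sigma>h + u *s frame.cross \<upsilon> \<sigma>0 \<in> frame.peirce_zero \<upsilon> \<and>
      sharp \<sigma>h + u *s frame.cross \<upsilon> \<sigma>0
        = p1_sharp z s t u p x y *s \<pi> 1 + p2_sharp z s t u p x y *s \<pi> 2
        + p3_sharp z s t u p x y *s \<pi> 3 + p4_sharp z s t u p x y *s \<pi> 4 \<and>
      frame.cross \<sigma>0 \<sigma>h \<in> frame.peirce_half \<upsilon> \<and>
      frame.cross \<sigma>0 \<sigma>h
        = x1_sharp z s t u p x y *s \<chi>' 1 + x2_sharp z s t u p x y *s \<chi>' 2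
        + y1_sharp z s t u p x y *s \<psi>' 1 + y2_sharp z s t u p x y *s \<psi>' 2 \<and>
      sharp \<sigma> = u_sharp z s t u p x y *s \<upsilon>
        + p1_sharp z s t u p x y *s \<pi> 1 + p2_sharp z s t u p x y *s \<pi> 2
        + p3_sharp z s t u p x y *s \<pi> 3 + p4_sharp z s t u p x y *s \<pi> 4
        + x1_sharp z s t u p x y *s \<chi>' 1 + x2_sharp z s t u p x y *s \<chi>' 2
        + y1_sharp z s t u p x y *s \<psi>' 1 + y2_sharp z s t u p x y *s \<psi>' 2"
    if "\<sigma>0 = p 1 *s \<pi> 1 + p 2 *s \<pi> 2 + p 3 *s \<pi> 3 + p 4 *s \<pi> 4"
      and "\<sigma>h = x 1 *s \<chi>' 1 + x 2 *s \<chi>' 2 + y 1 *s \<psi>' 1 + y 2 *s \<psi>' 2"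
      and \<sigma>: "\<sigma> = u *s \<upsilon> + \<sigma>0 + \<sigma>h"
    for u p x y \<sigma>0 \<sigma>h \<sigma>
  proof -
    have \<sigma>0: "\<sigma>0 = scaled.zero_part (p 1) (p 2) (p 3) (p 4)"
      and \<sigma>h: "\<sigma>h = scaled.half_part (x 1) (x 2) (y 1) (y 2)"
      using that by (simp_all add: scaled.zero_part_def scaled.half_part_def)
    have mem: "\<sigma>0 \<in> frame.peirce_zero \<upsilon>" "\<sigma>h \<in> frame.peirce_half \<upsilon>"
      unfolding \<sigma>0 \<sigma>h by (rule scaled.zero_part_mem scaled.half_part_mem)+
    have S: "frame.S \<sigma>0 = u_sharp z s t u p x y"
      unfolding \<sigma>0 by (rule scaled.S_zero_part)
    have zero: "sharp \<sigma>h + u *s frame.cross \<upsilon> \<sigma>0 = scaled.zero_part (p1_sharp z s t u p x y)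
        (p2_sharp z s t u p x y) (p3_sharp z s t u p x y) (p4_sharp z s t u p x y)"
      unfolding \<sigma>0 \<sigma>h by (rule scaled.sharp_half_plus)
    have half: "frame.cross \<sigma>0 \<sigma>h = scaled.half_part (x1_sharp z s t u p x y)
        (x2_sharp z s t u p x y) (y1_sharp z s t u p x y) (y2_sharp z s t u p x y)"
      unfolding \<sigma>0 \<sigma>h by (rule scaled.zero_part_cross_half_part)
    have "sharp \<sigma> = u_sharp z s t u p x y *s \<upsilon>
        + (sharp \<sigma>h + u *s frame.cross \<upsilon> \<sigma>0) + frame.cross \<sigma>0 \<sigma>h"
      unfolding \<sigma> S[symmetric] by (rule frame.sharp_peirce[OF mem])
    with mem S zero half show ?thesis
      using scaled.zero_part_mem scaled.half_part_mem
      by (simp add: scaled.zero_part_def scaled.half_part_def add.assoc)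
  qed
  have norm: "N (u *s \<upsilon> + p 1 *s \<pi> 1 + p 2 *s \<pi> 2 + p 3 *s \<pi> 3 + p 4 *s \<pi> 4
      + x 1 *s \<chi>' 1 + x 2 *s \<chi>' 2 + y 1 *s \<psi>' 1 + y 2 *s \<psi>' 2) = norm_formula z s t u p x y"
    for u p x y
    using scaled.norm_parts[of u p x y]
    by (simp add: scaled.zero_part_def scaled.half_part_def add.assoc)
  have poly: "(N_Upsilon z s t u p x y :: rat)
      = eval_int_poly norm_int_poly (assignment z s t u p x y)" for z s t u p x y
    by (simp add: eval_norm_int_poly N_Upsilon_eq_norm_formula)
  show ?thesis
    unfolding Let_def
    apply (rule exI[of _ c], rule exI[of _ c])
    unfolding params \<psi>'_def[symmetric] \<chi>'_def[symmetric]
    by (intro conjI c frame' allI impI exI[of _ norm_int_poly] adjoint poly)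
      (simp_all only: norm eval_norm_int_poly N_Upsilon_eq_norm_formula not_False_eq_True)
qed

end
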